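(* Let $w,v\in\mathbb{C}$ and let $R\geq1$ be an integer. As real $n\to\infty$: \begin{align*} S_n(1;v)&=\sum_{r=0}^{R-1}\frac{1}{n^r}\left(\rho_r(v)+\frac{\gamma_r(v)}{2}\sqrt{2\pi n}\right)+O\!\left(\frac{1}{n^{R-1/2}}\right),\\ S_n(w;v)&=\sum_{r=0}^{R-1}\frac{U_r(w;v)}{n^r}+O\!\left(\frac1{n^R}\right)\qquad (w\in\mathcal{X}\cup\mathcal{Y}\cup\mathcal{S}),\\ S_n(w;v)&=\sum_{r=0}^{R-1}\frac{1}{n^r}\left(U_r(w;v)+\gamma_r(v)\frac{e^{ni\varphi(w)}}{w^v}\sqrt{2\pi n}\right)+O\!\left(\frac{1}{n^{R-1/2}}\right)\qquad (w\in\mathcal{T}),\\ S_n(w;v)&=\frac{\sqrt{2\pi n}}{(we^{1-w})^n w^v}\left(\sum_{r=0}^{R-1}\frac{\gamma_r(v)}{n^r}+O\!\left(\frac1{n^R}\right)\right)\qquad(w\in\mathcal{Z}). \end{align*}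
   Context: Logarithms use the principal branch with arguments in $(-\pi,\pi]$; $w^v=e^{v\log w}$, $(nw)^{-(n+v)}=e^{-(n+v)\log n}e^{-(n+v)\log w}$, and $(we^{1-w})^n:=e^{n\log w+n(1-w)}$. For real $n>0$, $v\in\mathbb{C}$ with $\mathrm{Re}(n+v)>-1$ and $w\in\mathbb{C}$, define $S_n(w;v)=1+nw\int_0^1 e^{nw(1-z)}z^{n+v}\,dz$ (for integers $n\geq1$, $n+v\geq0$, $w\ne0$ this is the number with $e^{nw}=\sum_{j=0}^{n+v-1}\frac{(nw)^j}{j!}+\frac{(nw)^{n+v}}{(n+v)!}S_n(w;v)$). Regions: $\mathcal{X}=\{w:|we^{1-w}|>1\}$; $\mathcal{Y}=\{w:|we^{1-w}|<1,\ \mathrm{Re}(w)<1\}$; $\mathcal{Z}=\{w:|we^{1-w}|<1,\ \mathrm{Re}(w)>1\}$; $\mathcal{S}=\{w:|we^{1-w}|=1,\ \mathrm{Re}(w)<1\}$; $\mathcal{T}=\{w:|we^{1-w}|=1,\ \mathrm{Re}(w)>1\}$. For $|we^{1-w}|=1$, $\varphi(w):=\mathrm{Im}(w)-\arg(w)$ (real, with $we^{1-w}=e^{-i\varphi(w)}$). De Moivre polynomial $\mathcal{A}_{n,k}(a_1,a_2,\dots)$: coefficient of $x^n$ in $(a_1x+a_2x^2+\cdots)^k$. Double factorial $n!!$ as usual with $0!!=(-1)!!=1$; $\binom{v}{j}=v(v-1)\cdots(v-j+1)/j!$; $\delta_{r,0}$ Kronecker delta. Coefficients: $\rho_r(v)=\delta_{r,0}-\sum_{m=0}^{2r+1}(-1)^m\binom{v}{2r+1-m}\sum_{k=0}^{m}\frac{(2r+2k)!!}{(-1)^k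 k!}\mathcal{A}_{m,k}(\frac13,\frac14,\frac15,\dots)$; $\gamma_r(v)=\sum_{m=0}^{2r}(-1)^m\binom{v}{2r-m}\sum_{k=0}^{m}\frac{(2r+2k-1)!!}{(-1)^k k!}\mathcal{A}_{m,k}(\frac13,\frac14,\frac15,\dots)$; $U_r(w;v)=\delta_{r,0}-\sum_{m=0}^{r}(-1)^m\binom{v}{r-m}\sum_{k=0}^{m}\frac{w}{(w-1)^{r+k+1}}\frac{(r+k)!}{k!}\mathcal{A}_{m,k}(\frac12,\frac13,\frac14,\dots)$. *)

theory Defs
  imports "HOL-Analysis.Analysis" "HOL-Library.Landau_Symbols"
          "HOL-Computational_Algebra.Formal_Power_Series"
begin

definition S_fun :: "real \<Rightarrow> complex \<Rightarrow> complex \<Rightarrow> complex" where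
  "S_fun n w v = 1 + of_real n * w *
     integral {0..1::real} (\<lambda>z. exp (of_real n * w * (1 - of_real z)) * (of_real z) powr (of_real n + v))"

(* (w e^{1-w})^n := e^{n log w + n(1-w)} *)
definition wpow :: "real \<Rightarrow> complex \<Rightarrow> complex" where
  "wpow n w = exp (of_real n * Ln w + of_real n * (1 - w))"

definition regionX :: "complex set" where "regionX = {w. norm (w * exp (1 - w)) > 1}"
definition regionY :: "complex set" where "regionY = {w. norm (w * exp (1 - w)) < 1 \<and> Re w < 1}"
definition regionZ :: "complex set" where "regionZ = {w. norm (w * exp (1 - w)) < 1 \<and> Re w > 1}"
definition regionS :: "complex set" where "regionS = {w. norm (w * exp (1 - w)) = 1 \<and> Re w < 1}"
definition regionT :: "complex set" where "regionT = {w. norm (w * exp (1 - w)) = 1 \<and> Re w > 1}"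

definition phi :: "complex \<Rightarrow> real" where "phi w = Im w - Arg w"

definition deMoivre :: "nat \<Rightarrow> nat \<Rightarrow> (nat \<Rightarrow> complex) \<Rightarrow> complex" where
  "deMoivre n k a = fps_nth ((Abs_fps (\<lambda>j. if j = 0 then 0 else a j)) ^ k) n"

definition dfact :: "int \<Rightarrow> int" where
  "dfact m = (if m \<le> 0 then 1 else (\<Prod>i\<in>{0..<(m+1) div 2}. m - 2*i))"

(* the sequences (1/3,1/4,1/5,...) and (1/2,1/3,1/4,...), indexed from 1 *)
definition seq3 :: "nat \<Rightarrow> complex" where "seq3 j = 1 / of_nat (j + 2)"
definition seq2 :: "nat \<Rightarrow> complex" where "seq2 j = 1 / of_nat (j + 1)"

definition rho :: "nat \<Rightarrow> complex \<Rightarrow> complex" where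
  "rho r v = (if r = 0 then 1 else 0) -
     (\<Sum>m=0..2*r+1. (-1)^m * (v gchoose (2*r+1-m)) *
        (\<Sum>k=0..m. of_int (dfact (2*int r + 2*int k)) / ((-1)^k * fact k) * deMoivre m k seq3))"

definition gam :: "nat \<Rightarrow> complex \<Rightarrow> complex" where
  "gam r v = (\<Sum>m=0..2*r. (-1)^m * (v gchoose (2*r-m)) *
        (\<Sum>k=0..m. of_int (dfact (2*int r + 2*int k - 1)) / ((-1)^k * fact k) * deMoivre m k seq3))"

definition U :: "nat \<Rightarrow> complex \<Rightarrow> complex \<Rightarrow> complex" where
  "U r w v = (if r = 0 then 1 else 0) -
     (\<Sum>m=0..r. (-1)^m * (v gchoose (r-m)) *
        (\<Sum>k=0..m. w / (w - 1)^(r+k+1) * fact (r+k) / fact k * deMoivre m k seq2))"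

end

theory Submission
  imports Defs "HOL-Complex_Analysis.Complex_Analysis" "HOL-Probability.Distributions"
    "HOL-Real_Asymp.Real_Asymp"
begin

text \<open>
  With \<open>z = 1 - t\<close> one has \<open>S\<^sub>n(w;v) = 1 + n w L(w)\<close>, where
  \<open>L(w) = \<integral>\<^sub>0\<^sup>1 exp (n (w t + log (1 - t))) (1 - t)\<^sup>v dt\<close>. For \<open>Re w < 1\<close> the phase is maximal only
  at \<open>t = 0\<close>, and Laplace's method gives the coefficients \<open>U\<^sub>r\<close>. For \<open>w = 1\<close> the phase
  vanishes to second order and the half-range Gaussian moments give \<open>\<rho>\<^sub>r\<close> and \<open>\<gamma>\<^sub>r\<close>.

  For \<open>Re w \<ge> 1\<close>, \<open>w \<noteq> 1\<close>, put \<open>Q(w) = \<integral>\<^sub>0\<^sup>\<infinity> exp (n (- s + log (1 + s/w))) (1 + s/w)\<^sup>v ds\<close>. By Cauchy's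
  theorem \<open>w L(w) + Q(w)\<close> is \<open>(L(1) + Q(1)) / ((w e\<^bsup>1-w\<^esup>)\<^sup>n w\<^sup>v)\<close>: both are the same Gamma integral up to
  a factor. Since \<open>|1 + s/w| \<le> 1 + s\<close>, the phase of \<open>Q(w)\<close> is again maximal only at the endpoint, so
  \<open>1 - n Q(w)\<close> has the expansion with coefficients \<open>U\<^sub>r\<close>, while \<open>L(1) + Q(1)\<close> yields
  Stirling's series with coefficients \<open>\<gamma>\<^sub>r\<close>. The size of \<open>w e\<^bsup>1-w\<^esup>\<close> decides which part dominates.

  In the Laplace expansion \<open>exp (- x \<phi>(t)) \<gamma>(t)\<close> is expanded in \<open>t\<close> for a fixed value of \<open>x = n t\<^sup>p\<close>; Cauchy's
  estimates bound the remainder by a multiple of \<open>e\<^bsup>\<delta>x\<^esup> t\<^sup>Q\<close> with small \<open>\<delta>\<close>, which the factor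
  \<open>e\<^bsup>-ax\<^esup>\<close> absorbs.
\<close>

section \<open>Cauchy estimates for Taylor coefficients and remainders\<close>

lemma has_fps_expansion_norm_nth_le:
  assumes "f holomorphic_on ball 0 r0" "0 < r" "r < r0"
    and "\<And>z. norm z \<le> r \<Longrightarrow> norm (f z) \<le> B" and "f has_fps_expansion F"
  shows "norm (fps_nth F q) \<le> B / r ^ q"
proof -
  have "norm ((deriv ^^ q) f 0) \<le> fact q * B / r ^ q"
  proof (rule Cauchy_inequality)
    show "f holomorphic_on ball 0 r"
      using assms by (auto intro: holomorphic_on_subset)
    show "continuous_on (cball 0 r) f"
      using assms by (auto intro!: holomorphic_on_imp_continuous_on holomorphic_on_subset[OF assms(1)])
  qed (use assms in auto)
  then show ?thesis
    by (simp add: fps_nth_fps_expansion[OF assms(5)] norm_divide field_simps)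
qed

text \<open>Inside half the radius, Cauchy's estimate dominates the tail by a geometric series of
  ratio 1/2, whose sum gives the factor 2. The bound is linear in B, so the lemma can be applied
  uniformly to a family of functions whose B depends on a parameter.\<close>

lemma has_fps_expansion_remainder_le:
  assumes "f holomorphic_on ball 0 r0" "0 < r" "r < r0"
    and "\<And>z. norm z \<le> r \<Longrightarrow> norm (f z) \<le> B" and "f has_fps_expansion F"
    and "norm z \<le> r / 2"
  shows "norm (f z - (\<Sum>q<Q. fps_nth F q * z ^ q)) \<le> 2 * B * (norm z / r) ^ Q"
proof -
  have B0: "0 \<le> B"
    using assms(4)[of 0] assms(2) norm_ge_zero[of "f 0"] by (simp del: norm_ge_zero)
  have "(\<lambda>n. fps_nth F n * z ^ n) sums f z"
    using holomorphic_power_series[OF assms(1), of z] assms(2,3,6)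
    by (simp add: fps_nth_fps_expansion[OF assms(5)])
  then have s: "(\<lambda>i. fps_nth F (i + Q) * z ^ (i + Q)) sums (f z - (\<Sum>q<Q. fps_nth F q * z ^ q))"
    by (subst sums_iff_shift) simp
  have le: "norm (fps_nth F (i + Q) * z ^ (i + Q)) \<le> B * (norm z / r) ^ Q * (1/2) ^ i" for i
  proof -
    have "norm (fps_nth F (i + Q) * z ^ (i + Q)) \<le> B / r ^ (i + Q) * norm z ^ (i + Q)"
      unfolding norm_mult norm_power
      by (intro mult_right_mono has_fps_expansion_norm_nth_le[OF assms(1-5)]) auto
    also have "\<dots> = B * (norm z / r) ^ Q * (norm z / r) ^ i"
      by (simp add: power_add power_divide mult_ac)
    also have "\<dots> \<le> B * (norm z / r) ^ Q * (1/2) ^ i"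
      using assms(2,6) B0 by (intro mult_left_mono power_mono) (auto simp: field_simps)
    finally show ?thesis .
  qed
  have g: "(\<lambda>i. B * (norm z / r) ^ Q * (1/2) ^ i) sums (B * (norm z / r) ^ Q * 2)"
    using geometric_sums[of "1/2::real"] by (intro sums_mult) simp
  have "norm (\<Sum>i. fps_nth F (i + Q) * z ^ (i + Q)) \<le> (\<Sum>i. B * (norm z / r) ^ Q * (1/2) ^ i)"
    by (intro norm_suminf_le le) (use g in \<open>simp add: sums_iff\<close>)
  then show ?thesis
    using g s by (simp add: sums_iff mult_ac)
qed

subsection \<open>Laplace's method at an endpoint\<close>

text \<open>With x = n t^p, the coefficient of t^q in exp(-x phi(t)) gamma(t) is a polynomial in x.
  Its term in x^k contributes n^k t^(p k + q), whose moment scales as n^(-(q+1)/p) for every k;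
  hence the index \<open>p * k + q\<close>. \<open>M s\<close> stands for the s-th moment of exp(-a
  t^p).\<close>

definition laplace_coeff ::
    "nat \<Rightarrow> (nat \<Rightarrow> complex) \<Rightarrow> complex fps \<Rightarrow> complex fps \<Rightarrow> nat \<Rightarrow> complex" where
  "laplace_coeff p M \<Phi> G q =
     (\<Sum>m\<le>q. fps_nth G (q - m) * (\<Sum>k\<le>m. (-1)^k / fact k * fps_nth (\<Phi> ^ k) m * M (p * k + q)))"

text \<open>Where the phase has nonpositive real part, the modulus of the integrand decreases in n,
  so integrability at a single \<open>n0\<close> carries over to all larger n.\<close>

lemma set_integrable_exp_phase:
  fixes f g :: "real \<Rightarrow> complex"
  assumes [measurable]: "D \<in> sets borel" "f \<in> borel_measurable borel" "g \<in> borel_measurable borel"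
    and "set_integrable lborel D (\<lambda>t. exp (of_real n0 * f t) * g t)"
    and "\<And>t. t \<in> D \<Longrightarrow> Re (f t) \<le> 0" "n0 \<le> n"
  shows "set_integrable lborel D (\<lambda>t. exp (of_real n * f t) * g t)"
  using assms(4)
proof (rule set_integrable_bound)
  show "set_borel_measurable lborel D (\<lambda>t. exp (of_real n * f t) * g t)"
    unfolding set_borel_measurable_def by measurable
  show "AE t in lborel. t \<in> D \<longrightarrow> norm (exp (of_real n * f t) * g t) \<le> norm (exp (of_real n0 * f t) * g t)"
    unfolding norm_mult
    by (intro AE_I2 impI mult_right_mono) (simp_all add: assms(5,6) mult_right_mono_neg)
qed

text \<open>The Taylor series in t at fixed x = n t^p is truncated but integrated over the whole
  half-line, so the moments enter exactly. \<open>moment\<close> evaluates the main terms with the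
  complex rate a, \<open>moment'\<close> the error with a smaller real rate, and \<open>away\<close>
  makes the part of D far from 0 exponentially small.\<close>

theorem laplace_expansion:
  fixes f g :: "real \<Rightarrow> complex" and \<phi> \<gamma> :: "complex \<Rightarrow> complex"
  assumes meas [measurable]: "D \<in> sets borel" "f \<in> borel_measurable borel" "g \<in> borel_measurable borel"
    and D: "D \<subseteq> {0..}" "{0..<r0} \<subseteq> D" and r0: "r0 > 0" and a: "Re a > 0"
    and hol: "\<phi> holomorphic_on ball 0 r0" "\<gamma> holomorphic_on ball 0 r0"
    and fps: "\<phi> has_fps_expansion \<Phi>" "\<gamma> has_fps_expansion G" "fps_nth \<Phi> 0 = 0"
    and near: "\<And>t. 0 \<le> t \<Longrightarrow> t < r0 \<Longrightarrow> f t = - (of_real t ^ p * (a + \<phi> (of_real t)))"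
              "\<And>t. 0 \<le> t \<Longrightarrow> t < r0 \<Longrightarrow> g t = \<gamma> (of_real t)"
    and away: "\<And>d. d > 0 \<Longrightarrow> \<exists>\<eta>>0. \<forall>t\<in>D. t \<ge> d \<longrightarrow> Re (f t) \<le> -\<eta>"
    and int: "set_integrable lborel D (\<lambda>t. exp (of_real n0 * f t) * g t)"
    and moment: "\<And>n s. n > 0 \<Longrightarrow> has_bochner_integral lborel
        (\<lambda>t. indicator {0..} t *\<^sub>R (exp (- (of_real n * a * of_real t ^ p)) * of_real t ^ s))
        (M s * of_real (n powr (- (real s + 1) / real p)))"
    and moment': "\<And>b. b > 0 \<Longrightarrow> \<exists>C. \<forall>n>0. has_bochner_integral lborel
        (\<lambda>t. indicator {0..} t *\<^sub>R (exp (- (n * b * t ^ p)) * t ^ Q))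
        (C * n powr (- (real Q + 1) / real p))"
    and p: "p > 0"
  shows "(\<lambda>n. (LINT t:D|lborel. exp (of_real n * f t) * g t) -
            (\<Sum>q<Q. laplace_coeff p M \<Phi> G q * of_real (n powr (- (real q + 1) / real p))))
         \<in> O[at_top](\<lambda>n. of_real (n powr (- (real Q + 1) / real p)))"
proof -
  \<comment> \<open>Half of the decay rate is given up: r is chosen so small that |phi| <= b on the
    disc. Then exp(-x phi) grows at most like exp(b x), and multiplication by exp(-a x) still leaves
    decay like exp(-b x).\<close>
  define b where "b = Re a / 2"
  have b: "b > 0" using a by (simp add: b_def)
  obtain r where r: "0 < r" "r < r0" and \<phi>_le: "\<And>z. norm z \<le> r \<Longrightarrow> norm (\<phi> z) \<le> b"
  proof -
    have c: "isCont \<phi> 0"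
      using hol(1) r0 by (auto intro: holomorphic_on_imp_continuous_on continuous_on_interior)
    have "\<phi> 0 = 0" using fps has_fps_expansion_imp_0_eq_fps_nth_0 by metis
    with c b obtain d where d: "d > 0" "\<And>z. norm z < d \<Longrightarrow> norm (\<phi> z) < b"
      unfolding continuous_at_eps_delta by (metis dist_0_norm dist_commute)
    show ?thesis
      by (rule that[of "min d r0 / 2"]) (use d r0 in \<open>auto intro!: less_imp_le[OF d(2)]\<close>)
  qed
  obtain B where B: "\<And>z. norm z \<le> r \<Longrightarrow> norm (\<gamma> z) \<le> B"
  proof -
    have "continuous_on (cball 0 r) \<gamma>"
      using r by (auto intro!: holomorphic_on_imp_continuous_on holomorphic_on_subset[OF hol(2)])
    then have "bounded (\<gamma> ` cball 0 r)"
      by (intro compact_imp_bounded compact_continuous_image) auto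
    then show ?thesis
      using that by (force simp: bounded_iff)
  qed
  have B0: "B \<ge> 0" using B[of 0] r norm_ge_zero[of "\<gamma> 0"] by (simp del: norm_ge_zero)
  \<comment> \<open>Here x is a parameter independent of z, which makes \<open>E x\<close>
    holomorphic in z with Taylor series \<open>P x\<close>. The value x = n t^p is inserted only
    afterwards.\<close>
  define E where "E x z = exp (- of_real x * \<phi> z) * \<gamma> z" for x :: real and z
  define P where "P x = (fps_exp (- of_real x) oo \<Phi>) * G" for x :: real
  have E_hol: "E x holomorphic_on ball 0 r0" for x
    unfolding E_def by (intro holomorphic_intros hol)
  have E_fps: "E x has_fps_expansion P x" for x
  proof -
    have "((\<lambda>u. exp (- of_real x * u)) \<circ> \<phi>) has_fps_expansion (fps_exp (- of_real x) oo \<Phi>)"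
      by (intro has_fps_expansion_compose has_fps_expansion_exp fps)
    from has_fps_expansion_mult[OF this fps(2)] show ?thesis
      by (simp add: E_def[abs_def] P_def o_def)
  qed
  have E_le: "norm (E x z) \<le> B * exp (x * b)" if "x \<ge> 0" "norm z \<le> r" for x z
  proof -
    have "Re (- of_real x * \<phi> z) \<le> x * b"
      using that \<phi>_le[of z] abs_Re_le_cmod[of "\<phi> z"] mult_left_mono[of "- Re (\<phi> z)" b x] by auto
    then have "norm (exp (- of_real x * \<phi> z)) \<le> exp (x * b)" by simp
    then show ?thesis
      using B[of z] that B0 unfolding E_def norm_mult by (subst mult.commute, intro mult_mono) auto
  qed
  have P_nth: "fps_nth (P x) q = (\<Sum>m\<le>q. \<Sum>k\<le>m. fps_nth G (q - m) *
      ((-1)^k / fact k * fps_nth (\<Phi> ^ k) m) * of_real x ^ k)" for x q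
  proof -
    have "fps_nth (P x) q = (\<Sum>m\<le>q. (\<Sum>k\<le>m. (- of_real x) ^ k / fact k * fps_nth (\<Phi> ^ k) m) * fps_nth G (q - m))"
      by (simp add: P_def fps_mult_nth fps_compose_nth atLeast0AtMost)
    also have "\<dots> = (\<Sum>m\<le>q. \<Sum>k\<le>m. fps_nth G (q - m) *
      ((-1)^k / fact k * fps_nth (\<Phi> ^ k) m) * of_real x ^ k)"
      unfolding sum_distrib_left sum_distrib_right
      by (intro sum.cong refl) (simp add: power_minus[of "of_real x"] mult_ac)
    finally show ?thesis .
  qed
  define A where "A n t = exp (- (of_real n * a * of_real t ^ p)) *
      (\<Sum>q<Q. fps_nth (P (n * t ^ p)) q * of_real t ^ q)" for n t :: real
  have A_int: "has_bochner_integral lborel (\<lambda>t. indicator {0..} t *\<^sub>R A n t)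
      (\<Sum>q<Q. laplace_coeff p M \<Phi> G q * of_real (n powr (- (real q + 1) / real p)))" if n: "n > 0" for n
  proof -
    let ?c = "\<lambda>q m k. fps_nth G (q - m) * ((-1)^k / fact k * fps_nth (\<Phi> ^ k) m) * of_real n ^ k"
    have "has_bochner_integral lborel (\<lambda>t. \<Sum>q<Q. \<Sum>m\<le>q. \<Sum>k\<le>m. ?c q m k *
        (indicator {0..} t *\<^sub>R (exp (- (of_real n * a * of_real t ^ p)) * of_real t ^ (p * k + q))))
       (\<Sum>q<Q. \<Sum>m\<le>q. \<Sum>k\<le>m. ?c q m k * (M (p * k + q) *
          of_real (n powr (- (real (p * k + q) + 1) / real p))))"
      by (intro has_bochner_integral_sum has_bochner_integral_mult_right moment n)
    also have "(\<lambda>t. \<Sum>q<Q. \<Sum>m\<le>q. \<Sum>k\<le>m. ?c q m k *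
        (indicator {0..} t *\<^sub>R (exp (- (of_real n * a * of_real t ^ p)) * of_real t ^ (p * k + q))))
        = (\<lambda>t. indicator {0..} t *\<^sub>R A n t)"
      unfolding A_def P_nth scaleR_conv_of_real sum_distrib_left sum_distrib_right
      by (intro ext sum.cong refl)
        (simp only: power_add power_mult power_mult_distrib of_real_mult of_real_power,
         simp only: mult_ac)
    also have "(\<Sum>q<Q. \<Sum>m\<le>q. \<Sum>k\<le>m. ?c q m k * (M (p * k + q) *
          of_real (n powr (- (real (p * k + q) + 1) / real p)))) =
        (\<Sum>q<Q. laplace_coeff p M \<Phi> G q * of_real (n powr (- (real q + 1) / real p)))"
      unfolding laplace_coeff_def sum_distrib_left sum_distrib_right
    proof (intro sum.cong refl)
      fix q m k
      have "- (real (p * k + q) + 1) / real p + real k = - (real q + 1) / real p"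
        using p by (simp add: field_simps)
      then have "n ^ k * n powr (- (real (p * k + q) + 1) / real p) = n powr (- (real q + 1) / real p)"
        using n by (metis mult.commute powr_add powr_realpow)
      then have e: "of_real (n powr (- (real q + 1) / real p)) =
          of_real n ^ k * complex_of_real (n powr (- (real (p * k + q) + 1) / real p))"
        by (metis of_real_mult of_real_power)
      show "?c q m k * (M (p * k + q) * of_real (n powr (- (real (p * k + q) + 1) / real p))) =
         fps_nth G (q - m) * ((-1)^k / fact k * fps_nth (\<Phi> ^ k) m * M (p * k + q)) *
           of_real (n powr (- (real q + 1) / real p))"
        unfolding e by (simp only: mult_ac)
    qed
    finally show ?thesis .
  qed
  obtain \<eta> where \<eta>: "\<eta> > 0" "\<And>t. t \<in> D \<Longrightarrow> t \<ge> r / 2 \<Longrightarrow> Re (f t) \<le> -\<eta>"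
    using away[of "r/2"] r by auto
  obtain C where C: "\<And>n. n > 0 \<Longrightarrow> has_bochner_integral lborel
        (\<lambda>t. indicator {0..} t *\<^sub>R (exp (- (n * b * t ^ p)) * t ^ Q))
        (C * n powr (- (real Q + 1) / real p))"
    using moment'[OF b] by blast
  \<comment> \<open>The first summand serves the truncated series beyond r / 2, the second the
    Taylor remainder up to r / 2.\<close>
  define K where "K = B * 2 ^ Q * real Q / r ^ Q + 2 * B / r ^ Q"
  have K0: "B * 2 ^ Q * real Q / r ^ Q \<le> K" "2 * B / r ^ Q \<le> K" "0 \<le> K"
    using B0 r by (auto simp: K_def)
  let ?F = "\<lambda>n t. exp (of_real n * f t) * g t"
  have f_le0: "Re (f t) \<le> 0" if "t \<in> D" for t
  proof (cases "t > 0")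
    case True
    with away[of t] that show ?thesis by force
  next
    case False
    with that D have "t = 0" by auto
    then show ?thesis using near(1)[of 0] r0 p by (simp add: zero_power)
  qed
  \<comment> \<open>One majorant for all t: its first summand covers the Taylor remainder near 0 and
    the truncated series far from 0, its second the integrand itself beyond r / 2.\<close>
  have pointwise: "norm (indicator D t *\<^sub>R ?F n t - indicator {0..} t *\<^sub>R A n t) \<le>
      K * (indicator {0..} t *\<^sub>R (exp (- (n * b * t ^ p)) * t ^ Q)) +
      exp (- (n - n0) * \<eta>) * (indicator D t *\<^sub>R norm (?F n0 t))" if n: "n > 0" "n \<ge> n0" for n t
  proof (cases "t \<ge> 0")
    case False
    with D have "t \<notin> D" by auto
    with False show ?thesis by simp
  next
    case t: True
    define x where "x = n * t ^ p"
    have x: "x \<ge> 0" using n t by (simp add: x_def)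
    have ex: "norm (exp (- (of_real n * a * of_real t ^ p))) * exp (x * b) = exp (- (n * b * t ^ p))"
    proof -
      have "Re (- (of_real n * a * of_real t ^ p)) = - (2 * b * x)"
        by (simp add: b_def x_def of_real_power[symmetric] mult_ac del: of_real_power)
      then show ?thesis
        unfolding norm_exp_eq_Re by (simp only: exp_add[symmetric] x_def) (simp add: algebra_simps)
    qed
    show ?thesis
    proof (cases "t \<le> r / 2")
      case True
      have tD: "t \<in> D" using D r t True by auto
      have "norm (E x (of_real t) - (\<Sum>q<Q. fps_nth (P x) q * of_real t ^ q)) \<le>
          2 * (B * exp (x * b)) * (norm (complex_of_real t) / r) ^ Q"
        using True t
        by (intro has_fps_expansion_remainder_le[OF E_hol r E_le[OF x] E_fps]) auto
      also have "\<dots> = 2 * B / r ^ Q * exp (x * b) * t ^ Q"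
        using t by (simp add: power_divide)
      also have "\<dots> \<le> K * exp (x * b) * t ^ Q"
        using K0 t by (intro mult_right_mono) auto
      finally have *: "norm (E x (of_real t) - (\<Sum>q<Q. fps_nth (P x) q * of_real t ^ q)) \<le> K * exp (x * b) * t ^ Q" .
      have "?F n t = exp (- (of_real n * a * of_real t ^ p)) * E x (of_real t)"
      proof -
        have "t < r0" using True r by simp
        from near[OF t this] show ?thesis
          by (simp only: E_def mult.assoc[symmetric] exp_add[symmetric])
            (simp add: x_def algebra_simps)
      qed
      then have "?F n t - A n t = exp (- (of_real n * a * of_real t ^ p)) *
         (E x (of_real t) - (\<Sum>q<Q. fps_nth (P x) q * of_real t ^ q))"
        by (simp add: A_def x_def algebra_simps)
      then have "norm (?F n t - A n t) = norm (exp (- (of_real n * a * of_real t ^ p))) *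
         norm (E x (of_real t) - (\<Sum>q<Q. fps_nth (P x) q * of_real t ^ q))"
        by (simp only: norm_mult)
      also have "\<dots> \<le> norm (exp (- (of_real n * a * of_real t ^ p))) * (K * exp (x * b) * t ^ Q)"
        by (intro mult_left_mono *) auto
      also have "\<dots> = K * (exp (- (n * b * t ^ p)) * t ^ Q)"
        unfolding ex[symmetric] by (simp add: mult_ac)
      finally show ?thesis using tD t by (simp add: add_increasing2)
    next
      case False
      have tr: "t / r \<ge> 1/2" using False r by (simp add: field_simps)
      have "norm (\<Sum>q<Q. fps_nth (P x) q * of_real t ^ q) \<le> (\<Sum>q<Q. B * exp (x * b) * (2 ^ Q * (t / r) ^ Q))"
      proof (intro sum_norm_le)
        fix q assume "q \<in> {..<Q}"
        then have q: "q < Q" by simp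
        \<comment> \<open>Far from 0 the terms of degree below Q are absorbed into t^Q, because 2 t
          / r >= 1 makes the powers of 2 t / r increase with the degree.\<close>
        have pw: "y ^ q \<le> 2 ^ Q * y ^ Q" if "y \<ge> 1/2" for y :: real
        proof -
          have "y ^ q \<le> (2 * y) ^ q" using that by (intro power_mono) auto
          also have "\<dots> \<le> (2 * y) ^ Q" using that q by (intro power_increasing) auto
          finally show ?thesis by (simp add: power_mult_distrib)
        qed
        have "norm (fps_nth (P x) q * of_real t ^ q) \<le> B * exp (x * b) / r ^ q * t ^ q"
          unfolding norm_mult norm_power
          using t by (intro mult_mono has_fps_expansion_norm_nth_le[OF E_hol r E_le[OF x] E_fps])
            (use B0 r in auto)
        also have "\<dots> = B * exp (x * b) * (t / r) ^ q" by (simp add: power_divide)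
        also have "B * exp (x * b) * (t / r) ^ q \<le> B * exp (x * b) * (2 ^ Q * (t / r) ^ Q)"
          using B0 by (intro mult_left_mono pw tr) auto
        finally show "norm (fps_nth (P x) q * of_real t ^ q) \<le> B * exp (x * b) * (2 ^ Q * (t / r) ^ Q)" .
      qed
      also have "\<dots> = (B * 2 ^ Q * real Q / r ^ Q) * exp (x * b) * t ^ Q"
        by (simp add: power_divide)
      also have "\<dots> \<le> K * exp (x * b) * t ^ Q"
        using K0 t by (intro mult_right_mono) auto
      finally have *: "norm (\<Sum>q<Q. fps_nth (P x) q * of_real t ^ q) \<le> K * exp (x * b) * t ^ Q" .
      have "norm (A n t) \<le> norm (exp (- (of_real n * a * of_real t ^ p))) * (K * exp (x * b) * t ^ Q)"
        unfolding A_def norm_mult x_def[symmetric] by (intro mult_left_mono *) auto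
      also have "\<dots> = K * (exp (- (n * b * t ^ p)) * t ^ Q)"
        unfolding ex[symmetric] by (simp add: mult_ac)
      finally have A_le: "norm (A n t) \<le> K * (exp (- (n * b * t ^ p)) * t ^ Q)" .
      have F_le: "norm (?F n t) \<le> exp (- (n - n0) * \<eta>) * norm (?F n0 t)" if "t \<in> D"
      proof -
        have "Re (f t) \<le> -\<eta>" using \<eta> that False by auto
        then have "(n - n0) * Re (f t) \<le> (n - n0) * (-\<eta>)"
          using n by (intro mult_left_mono) auto
        then have "exp (n * Re (f t)) \<le> exp (- (n - n0) * \<eta>) * exp (n0 * Re (f t))"
          by (simp add: exp_add[symmetric] algebra_simps)
        then show ?thesis
          unfolding norm_mult mult.assoc[symmetric] by (intro mult_right_mono) auto
      qed
      show ?thesis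
      proof (cases "t \<in> D")
        case True
        then show ?thesis
          using norm_triangle_ineq4[of "?F n t" "A n t"] A_le F_le t by simp
      qed (use A_le t in simp)
    qed
  qed
  define J where "J = (LINT t:D|lborel. norm (?F n0 t))"
  have main: "norm ((LINT t:D|lborel. ?F n t) -
      (\<Sum>q<Q. laplace_coeff p M \<Phi> G q * of_real (n powr (- (real q + 1) / real p)))) \<le>
      K * (C * n powr (- (real Q + 1) / real p)) + exp (- (n - n0) * \<eta>) * J" if n: "n > 0" "n \<ge> n0" for n
  proof -
    have iF: "set_integrable lborel D (?F n)"
      by (rule set_integrable_exp_phase[OF meas int f_le0 n(2)])
    note iA = A_int[OF n(1)]
    have iN: "has_bochner_integral lborel (\<lambda>t. indicator D t *\<^sub>R norm (?F n0 t)) J"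
      unfolding J_def set_lebesgue_integral_def
      by (rule has_bochner_integral_integrable) (use set_integrable_norm[OF int] in \<open>simp add: set_integrable_def\<close>)
    have "has_bochner_integral lborel (\<lambda>t. indicator D t *\<^sub>R ?F n t - indicator {0..} t *\<^sub>R A n t)
        ((LINT t:D|lborel. ?F n t) - (\<Sum>q<Q. laplace_coeff p M \<Phi> G q * of_real (n powr (- (real q + 1) / real p))))"
      unfolding set_lebesgue_integral_def
      by (intro has_bochner_integral_diff iA has_bochner_integral_integrable)
        (use iF in \<open>simp add: set_integrable_def\<close>)
    note 1 = this
    have 2: "has_bochner_integral lborel (\<lambda>t. K * (indicator {0..} t *\<^sub>R (exp (- (n * b * t ^ p)) * t ^ Q)) +
      exp (- (n - n0) * \<eta>) * (indicator D t *\<^sub>R norm (?F n0 t)))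
      (K * (C * n powr (- (real Q + 1) / real p)) + exp (- (n - n0) * \<eta>) * J)"
      by (intro has_bochner_integral_add has_bochner_integral_mult_right C iN n)
    show ?thesis
      unfolding has_bochner_integral_integral_eq[OF 1, symmetric] has_bochner_integral_integral_eq[OF 2, symmetric]
      by (rule Bochner_Integration.integral_norm_bound_integral[OF integrable.intros[OF 1] integrable.intros[OF 2]])
        (rule pointwise[OF n])
  qed
  have "(\<lambda>n. norm ((LINT t:D|lborel. ?F n t) -
            (\<Sum>q<Q. laplace_coeff p M \<Phi> G q * of_real (n powr (- (real q + 1) / real p)))))
     \<in> O[at_top](\<lambda>n. K * (C * n powr (- (real Q + 1) / real p)) + exp (- (n - n0) * \<eta>) * J)"
  proof (rule bigoI[where c = 1], rule eventually_mono[OF eventually_ge_at_top[of "max 1 n0"]])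
    fix n assume "n \<ge> max 1 n0"
    then have "n > 0" "n \<ge> n0" by auto
    from main[OF this] show "norm (norm ((LINT t:D|lborel. ?F n t) -
            (\<Sum>q<Q. laplace_coeff p M \<Phi> G q * of_real (n powr (- (real q + 1) / real p))))) \<le>
       1 * norm (K * (C * n powr (- (real Q + 1) / real p)) + exp (- (n - n0) * \<eta>) * J)"
      unfolding real_norm_def mult_1 abs_norm_cancel by (rule order.trans) (rule abs_ge_self)
  qed
  also have "(\<lambda>n. K * (C * n powr (- (real Q + 1) / real p)) + exp (- (n - n0) * \<eta>) * J) \<in>
      O[at_top](\<lambda>n. n powr (- (real Q + 1) / real p))"
  proof (intro sum_in_bigo)
    have "(\<lambda>n. exp (- (n - n0) * \<eta>)) \<in> O[at_top](\<lambda>n. n powr e)" for e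
      using \<eta>(1) by real_asymp
    then show "(\<lambda>n. exp (- (n - n0) * \<eta>) * J) \<in> O[at_top](\<lambda>n. n powr (- (real Q + 1) / real p))"
      by simp
  qed simp
  finally show ?thesis
    by (simp only: bigo_def norm_of_real mem_Collect_eq abs_norm_cancel real_norm_def)
qed

subsection \<open>Moments\<close>

text \<open>Exhausting D by compact intervals treats [0,1) and the half-line alike. Only the values
  of F along the sequence \<open>u\<close> occur, so no limit of F at the open end has to be known
  beforehand.\<close>

lemma set_integral_FTC_tendsto:
  fixes F F' :: "real \<Rightarrow> 'a :: euclidean_space" and u :: "nat \<Rightarrow> real"
  assumes int: "set_integrable lborel D F'"
    and D: "D = (\<Union>i. {0..u i})" and u: "mono u" "\<And>i. u i \<ge> 0"
    and deriv: "\<And>t. t \<in> D \<Longrightarrow> (F has_vector_derivative F' t) (at t)"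
    and cont: "continuous_on D F'"
  shows "(\<lambda>i. F (u i) - F 0) \<longlonglongrightarrow> (LINT t:D|lborel. F' t)"
proof -
  have "(LINT t:{0..u i}|lborel. F' t) = F (u i) - F 0" for i
    unfolding set_lebesgue_integral_def
  proof (rule integral_FTC_Icc)
    show "0 \<le> u i" by (rule u)
    show "(F has_vector_derivative F' x) (at x within {0..u i})" if "0 \<le> x" "x \<le> u i" for x
    proof -
      have "x \<in> D" unfolding D using that by (intro UN_I[of i]) auto
      from deriv[OF this] show ?thesis by (rule has_vector_derivative_at_within)
    qed
    show "continuous_on {0..u i} F'"
      using cont by (rule continuous_on_subset) (auto simp: D)
  qed
  moreover have "(\<lambda>i. LINT t:{0..u i}|lborel. F' t) \<longlonglongrightarrow> (LINT t:(\<Union>i. {0..u i})|lborel. F' t)"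
    using int u unfolding D
    by (intro set_integral_cont_up) (auto simp: incseq_def mono_def intro: order.trans)
  ultimately show ?thesis by (simp add: D)
qed

lemma Ici_eq_UN_Icc_nat: "{0::real..} = (\<Union>i. {0..real i})"
  by (auto intro: real_arch_simple)

lemma exp_moment_real:
  fixes \<beta> :: real
  assumes "\<beta> > 0"
  shows "has_bochner_integral lborel (\<lambda>t. indicator {0..} t *\<^sub>R (exp (- (\<beta> * t)) * t ^ s))
           (fact s / \<beta> ^ (s + 1))"
proof -
  have "has_bochner_integral lborel (\<lambda>t::real. indicator {0..} t *\<^sub>R (exp (- t) * t ^ s)) (fact s)"
  proof (rule has_bochner_integral_nn_integral)
    have "(\<integral>\<^sup>+x. ennreal (indicator {0..} x *\<^sub>R (exp (- x) * x ^ s)) \<partial>lborel) =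
          (\<integral>\<^sup>+x. ennreal (x^s * exp (-x)) * indicator {0 ..} x \<partial>lborel)"
      by (intro nn_integral_cong) (auto split: split_indicator simp: mult_ac)
    then show "(\<integral>\<^sup>+x. ennreal (indicator {0..} x *\<^sub>R (exp (- x) * x ^ s)) \<partial>lborel) = ennreal (fact s)"
      by (simp add: nn_intergal_power_times_exp_Ici)
  qed (auto split: split_indicator)
  then have "has_bochner_integral lborel (\<lambda>t. indicator {0..} (0 + \<beta> * t) *\<^sub>R (exp (- (0 + \<beta> * t)) * (0 + \<beta> * t) ^ s)) (fact s /\<^sub>R \<bar>\<beta>\<bar>)"
    using assms by (subst lborel_has_bochner_integral_real_affine_iff[where c=\<beta> and t=0, symmetric]) auto
  then have "has_bochner_integral lborel (\<lambda>t. (1 / \<beta> ^ s) * (indicator {0..} (0 + \<beta> * t) *\<^sub>R (exp (- (0 + \<beta> * t)) * (0 + \<beta> * t) ^ s)))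
      (1 / \<beta> ^ s * (fact s /\<^sub>R \<bar>\<beta>\<bar>))"
    by (rule has_bochner_integral_mult_right)
  also have "(\<lambda>t. (1 / \<beta> ^ s) * (indicator {0..} (0 + \<beta> * t) *\<^sub>R (exp (- (0 + \<beta> * t)) * (0 + \<beta> * t) ^ s))) =
     (\<lambda>t. indicator {0..} t *\<^sub>R (exp (- (\<beta> * t)) * t ^ s))"
    using assms by (auto simp: fun_eq_iff power_mult_distrib zero_le_mult_iff split: split_indicator)
  also have "1 / \<beta> ^ s * (fact s /\<^sub>R \<bar>\<beta>\<bar>) = fact s / \<beta> ^ (s + 1)"
    using assms by (simp add: field_simps)
  finally show ?thesis .
qed

text \<open>Integration by parts gives c I(s) = s I(s-1) directly for complex c, which avoids
  rotating the contour. The real moment with rate Re c provides the dominating function.\<close>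

lemma exp_moment:
  fixes c :: complex
  assumes "Re c > 0"
  shows "has_bochner_integral lborel (\<lambda>t. indicator {0..} t *\<^sub>R (exp (- (c * of_real t)) * of_real t ^ s))
           (fact s / c ^ (s + 1))"
proof -
  let ?h = "\<lambda>s t. exp (- (c * of_real t)) * of_real t ^ s"
  have int: "set_integrable lborel {0..} (?h s)" for s
  proof (rule set_integrable_bound)
    show "set_integrable lborel {0..} (\<lambda>t. exp (- (Re c * t)) * t ^ s)"
      using exp_moment_real[OF assms, of s] by (auto simp: set_integrable_def has_bochner_integral_iff)
    show "set_borel_measurable lborel {0..} (?h s)"
      unfolding set_borel_measurable_def by measurable
  qed (auto simp: norm_mult norm_power)
  have lim: "(\<lambda>i. ?h s (real i)) \<longlonglongrightarrow> 0" for s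
  proof (rule tendsto_norm_zero_cancel)
    have "((\<lambda>x::real. exp (- (Re c * x)) * x ^ s) \<longlongrightarrow> 0) at_top"
      using assms by real_asymp
    then have "(\<lambda>i. exp (- (Re c * real i)) * real i ^ s) \<longlonglongrightarrow> 0"
      by (rule filterlim_compose) (rule filterlim_real_sequentially)
    then show "(\<lambda>i. norm (?h s (real i))) \<longlonglongrightarrow> 0"
      by (simp add: norm_mult norm_power)
  qed
  \<comment> \<open>At s = 0 the truncated difference \<open>s - 1\<close> is harmless because of
    the factor \<open>of_nat s\<close>. The right-hand side is -1 for s = 0 and 0 otherwise.\<close>
  have ftc: "(LINT t:{0..}|lborel. of_nat s * ?h (s - 1) t - c * ?h s t) = - ?h s 0" for s
  proof -
    have "set_integrable lborel {0..} (\<lambda>t. of_nat s * ?h (s - 1) t - c * ?h s t)"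
      by (intro set_integral_diff set_integrable_mult_right int)
    then have "(\<lambda>i. ?h s (real i) - ?h s 0) \<longlonglongrightarrow> (LINT t:{0..}|lborel. of_nat s * ?h (s - 1) t - c * ?h s t)"
    proof (rule set_integral_FTC_tendsto[OF _ Ici_eq_UN_Icc_nat])
      fix t :: real
      have "((\<lambda>z. exp (- (c * z)) * z ^ s) has_field_derivative
          of_nat s * ?h (s - 1) t - c * ?h s t) (at (of_real t))"
        by (auto intro!: derivative_eq_intros simp: algebra_simps)
      then show "(?h s has_vector_derivative of_nat s * ?h (s - 1) t - c * ?h s t) (at t)"
        by (rule has_vector_derivative_real_field)
    qed (auto intro!: continuous_intros simp: mono_def)
    moreover have "(\<lambda>i. ?h s (real i) - ?h s 0) \<longlonglongrightarrow> 0 - ?h s 0"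
      by (intro tendsto_intros lim)
    ultimately show ?thesis using LIMSEQ_unique by fastforce
  qed
  have c0: "c \<noteq> 0" using assms by auto
  have "(LINT t:{0..}|lborel. ?h s t) = fact s / c ^ (s + 1)"
  proof (induction s)
    case 0
    have "(LINT t:{0..}|lborel. - c * ?h 0 t) = - 1" using ftc[of 0] by simp
    then have "- c * (LINT t:{0..}|lborel. ?h 0 t) = -1" by (simp only: set_integral_mult_right)
    then show ?case using c0 by (simp add: field_simps)
  next
    case (Suc s)
    have "(LINT t:{0..}|lborel. of_nat (Suc s) * ?h s t - c * ?h (Suc s) t) = 0"
      using ftc[of "Suc s"] by simp
    then have "of_nat (Suc s) * (LINT t:{0..}|lborel. ?h s t) - c * (LINT t:{0..}|lborel. ?h (Suc s) t) = 0"
      by (subst (asm) set_integral_diff(2)) (auto intro!: set_integrable_mult_right int simp: set_integral_mult_right simp del: of_nat_Suc power_Suc)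
    then have "(LINT t:{0..}|lborel. ?h (Suc s) t) = of_nat (Suc s) * (LINT t:{0..}|lborel. ?h s t) / c"
      using c0 by (simp add: field_simps)
    then show ?case unfolding Suc by (simp add: mult_ac)
  qed
  with int[of s] show ?thesis
    by (simp add: has_bochner_integral_iff set_integrable_def set_lebesgue_integral_def)
qed

text \<open>This is Gamma((s+1)/2) / 2, the integral of exp(-t^2) t^s over the positive
  half-line.\<close>

definition gauss_moment :: "nat \<Rightarrow> real" where
  "gauss_moment s = (if even s then sqrt pi / 2 * (fact s / (2 ^ s * fact (s div 2)))
                     else fact (s div 2) / 2)"

lemma gauss_moment_scaled:
  fixes \<beta> :: real
  assumes "\<beta> > 0"
  shows "has_bochner_integral lborel (\<lambda>t. indicator {0..} t *\<^sub>R (exp (- (\<beta> * t\<^sup>2)) * t ^ s))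
           (gauss_moment s * \<beta> powr (- (real s + 1) / 2))"
proof -
  have *: "has_bochner_integral lborel (\<lambda>t::real. indicator {0..} t *\<^sub>R (exp (- t\<^sup>2) * t ^ s)) (gauss_moment s)"
  proof (cases "even s")
    case True
    then obtain k where "s = 2 * k" by blast
    then show ?thesis using gaussian_moment_even_pos[of k] by (simp add: gauss_moment_def)
  next
    case False
    then obtain k where "s = 2 * k + 1" by (auto elim: oddE)
    then show ?thesis using gaussian_moment_odd_pos[of k] by (simp add: gauss_moment_def)
  qed
  define c where "c = sqrt \<beta>"
  have c: "c > 0" "c\<^sup>2 = \<beta>" using assms by (auto simp: c_def)
  from * have "has_bochner_integral lborel (\<lambda>t. indicator {0..} (0 + c * t) *\<^sub>R (exp (- (0 + c * t)\<^sup>2) * (0 + c * t) ^ s)) (gauss_moment s /\<^sub>R \<bar>c\<bar>)"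
    using c by (subst lborel_has_bochner_integral_real_affine_iff[where c=c and t=0, symmetric]) auto
  then have "has_bochner_integral lborel (\<lambda>t. (1 / c ^ s) * (indicator {0..} (0 + c * t) *\<^sub>R (exp (- (0 + c * t)\<^sup>2) * (0 + c * t) ^ s)))
      (1 / c ^ s * (gauss_moment s /\<^sub>R \<bar>c\<bar>))"
    by (rule has_bochner_integral_mult_right)
  also have "(\<lambda>t. (1 / c ^ s) * (indicator {0..} (0 + c * t) *\<^sub>R (exp (- (0 + c * t)\<^sup>2) * (0 + c * t) ^ s))) =
     (\<lambda>t. indicator {0..} t *\<^sub>R (exp (- (\<beta> * t\<^sup>2)) * t ^ s))"
    using c by (auto simp: fun_eq_iff power_mult_distrib zero_le_mult_iff split: split_indicator)
  also have "1 / c ^ s * (gauss_moment s /\<^sub>R \<bar>c\<bar>) = gauss_moment s * \<beta> powr (- (real s + 1) / 2)"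
  proof -
    have "\<beta> powr (- (real s + 1) / 2) = (\<beta> powr (1/2)) powr (- real (s + 1))"
      by (simp add: powr_powr add.commute)
    also have "\<dots> = 1 / c ^ (s + 1)"
    proof -
      have "\<beta> powr (1/2) = c" using assms by (simp add: powr_half_sqrt c_def)
      then show ?thesis
        by (simp only: powr_minus powr_realpow[OF c(1)] inverse_eq_divide)
    qed
    finally show ?thesis using c by (simp add: field_simps)
  qed
  finally show ?thesis .
qed

subsection \<open>Logarithmic phases\<close>

text \<open>The series of -log(1 - z) after removal of its terms up to z^p and division by z^p. Its
  constant term is 0, so coefficients of its powers are de Moivre polynomials.\<close>

definition log_tail_fps :: "nat \<Rightarrow> complex fps" where
  "log_tail_fps p = Abs_fps (\<lambda>j. if j = 0 then 0 else 1 / of_nat (j + p))"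

lemma log_tail_fps_nth_0 [simp]: "fps_nth (log_tail_fps p) 0 = 0"
  by (simp add: log_tail_fps_def)

lemma fps_conv_radius_log_tail: "fps_conv_radius (log_tail_fps p) \<ge> 1"
  unfolding fps_conv_radius_def
proof (rule conv_radius_geI_ex')
  fix r :: real assume r: "0 < r" "ereal r < 1"
  show "summable (\<lambda>n. fps_nth (log_tail_fps p) n * of_real r ^ n)"
  proof (rule summable_comparison_test)
    show "summable (\<lambda>n. r ^ n)" using r by (intro summable_geometric) auto
    have "norm (fps_nth (log_tail_fps p) n) \<le> 1" for n
      by (simp add: log_tail_fps_def norm_divide del: of_nat_add)
    from mult_right_mono[OF this, of "r ^ n" for n]
    show "\<exists>N. \<forall>n\<ge>N. norm (fps_nth (log_tail_fps p) n * of_real r ^ n) \<le> r ^ n"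
      using r by (auto simp: norm_mult norm_power)
  qed
qed

lemma less_fps_conv_radius_log_tail:
  assumes "norm (z :: complex) < 1"
  shows "ereal (norm z) < fps_conv_radius (log_tail_fps p)"
proof -
  have "ereal (norm z) < 1" using assms by (simp add: one_ereal_def)
  also note fps_conv_radius_log_tail
  finally show ?thesis .
qed

lemma log_tail_eq:
  assumes "norm z < 1"
  shows "z ^ p * eval_fps (log_tail_fps p) z = - Ln (1 - z) - (\<Sum>i=1..p. z ^ i / of_nat i)"
proof -
  have "ereal (norm z) < fps_conv_radius (log_tail_fps p)"
    using assms by (rule less_fps_conv_radius_log_tail)
  then have "(\<lambda>j. fps_nth (log_tail_fps p) j * z ^ j) sums eval_fps (log_tail_fps p) z"
    by (rule sums_eval_fps)
  then have "(\<lambda>j. fps_nth (log_tail_fps p) (j + 1) * z ^ (j + 1)) sums eval_fps (log_tail_fps p) z"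
    by (subst sums_iff_shift) simp
  from sums_mult[OF this, of "z ^ p"]
  have 1: "(\<lambda>j. z ^ (j + Suc p) / of_nat (j + Suc p)) sums (z ^ p * eval_fps (log_tail_fps p) z)"
    by (simp add: log_tail_fps_def power_add mult_ac)
  have "(\<lambda>n. - (z ^ n / of_nat n)) sums Ln (1 - z)"
    using Ln_series'[of "-z"] assms by simp
  from sums_minus[OF this] have "(\<lambda>n. z ^ n / of_nat n) sums (- Ln (1 - z))" by simp
  then have "(\<lambda>j. z ^ (j + Suc p) / of_nat (j + Suc p)) sums (- Ln (1 - z) - (\<Sum>i<Suc p. z ^ i / of_nat i))"
    by (subst sums_iff_shift) simp
  with 1 have "z ^ p * eval_fps (log_tail_fps p) z = - Ln (1 - z) - (\<Sum>i<Suc p. z ^ i / of_nat i)"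
    using sums_unique2 by blast
  \<comment> \<open>The term at i = 0 vanishes because division by zero yields 0.\<close>
  also have "(\<Sum>i<Suc p. z ^ i / of_nat i) = (\<Sum>i=1..p. z ^ i / of_nat i)"
    by (intro sum.mono_neutral_right) (auto simp: Suc_le_eq)
  finally show ?thesis .
qed

text \<open>This is \<open>laplace_coeff\<close> for a logarithmic phase and the binomial factor (1
  - \<sigma> t)^v. The powers of \<sigma> from both series are collected in front as (-\<sigma>)^q,
  apart from \<sigma>^(p k), which comes from the factor \<sigma>^p of the phase.\<close>

definition log_coeff :: "nat \<Rightarrow> complex \<Rightarrow> (nat \<Rightarrow> complex) \<Rightarrow> complex \<Rightarrow> nat \<Rightarrow> complex" where
  "log_coeff p \<sigma> M v q = (- \<sigma>) ^ q * (\<Sum>m\<le>q. (-1) ^ m * (v gchoose (q - m)) *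
     (\<Sum>k\<le>m. (-1) ^ k / fact k * \<sigma> ^ (p * k) * fps_nth (log_tail_fps p ^ k) m * M (p * k + q)))"

text \<open>All Laplace integrals below have a phase of this shape: \<open>\<sigma>\<close> is one of
  \<open>1\<close>, \<open>-1\<close>, \<open>-1/w\<close>, and \<open>p\<close> is the order of vanishing of the phase at the endpoint.\<close>
theorem log_phase_expansion:
  fixes f g :: "real \<Rightarrow> complex"
  assumes meas [measurable]: "D \<in> sets borel" and D: "D \<subseteq> {0..}" "{0..<1} \<subseteq> D"
    and a: "Re a > 0" and \<sigma>: "norm \<sigma> \<le> 1" and p: "p > 0"
    and f: "\<And>t. f t = - (a * of_real t ^ p) + Ln (1 - \<sigma> * of_real t) + (\<Sum>i=1..p. (\<sigma> * of_real t) ^ i / of_nat i)"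
    and g: "\<And>t. g t = (1 - \<sigma> * of_real t) powr v"
    and away: "\<And>d. d > 0 \<Longrightarrow> \<exists>\<eta>>0. \<forall>t\<in>D. t \<ge> d \<longrightarrow> Re (f t) \<le> -\<eta>"
    and int: "set_integrable lborel D (\<lambda>t. exp (of_real n0 * f t) * g t)"
    and moment: "\<And>n s. n > 0 \<Longrightarrow> has_bochner_integral lborel
        (\<lambda>t. indicator {0..} t *\<^sub>R (exp (- (of_real n * a * of_real t ^ p)) * of_real t ^ s))
        (M s * of_real (n powr (- (real s + 1) / real p)))"
    and moment': "\<And>b. b > 0 \<Longrightarrow> \<exists>C. \<forall>n>0. has_bochner_integral lborel
        (\<lambda>t. indicator {0..} t *\<^sub>R (exp (- (n * b * t ^ p)) * t ^ Q))
        (C * n powr (- (real Q + 1) / real p))"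
  shows "(\<lambda>n. (LINT t:D|lborel. exp (of_real n * f t) * g t) -
            (\<Sum>q<Q. log_coeff p \<sigma> M v q * of_real (n powr (- (real q + 1) / real p))))
         \<in> O[at_top](\<lambda>n. of_real (n powr (- (real Q + 1) / real p)))"
proof -
  define T where "T = log_tail_fps p"
  \<comment> \<open>The logarithm together with its compensating sum is -(\<sigma> t)^p T(\<sigma>
    t); after t^p is split off, \<sigma>^p T(\<sigma> t) is left beside the constant a.\<close>
  define \<phi> where "\<phi> z = \<sigma> ^ p * eval_fps T (\<sigma> * z)" for z
  define \<gamma> where "\<gamma> z = (1 - \<sigma> * z) powr v" for z
  define \<Phi> where "\<Phi> = fps_const (\<sigma> ^ p) * (T oo (fps_const \<sigma> * fps_X))"
  define G where "G = fps_binomial v oo (fps_const (-\<sigma>) * fps_X)"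
  have small: "norm (\<sigma> * z) < 1" if "norm z < 1" for z
  proof -
    have "norm \<sigma> * norm z \<le> 1 * norm z" using \<sigma> by (intro mult_right_mono) auto
    with that show ?thesis by (simp add: norm_mult)
  qed
  have T: "eval_fps T holomorphic_on ball 0 1" "eval_fps T has_fps_expansion T"
  proof -
    show "eval_fps T holomorphic_on ball 0 1"
      unfolding T_def
      by (intro holomorphic_on_eval_fps) (auto simp: in_eball_iff less_fps_conv_radius_log_tail)
    show "eval_fps T has_fps_expansion T"
      using less_fps_conv_radius_log_tail[of 0 p] unfolding T_def
      by (intro eval_fps_has_fps_expansion) (simp add: zero_ereal_def)
  qed
  have lin: "(\<lambda>z. c * z) has_fps_expansion (fps_const c * fps_X)" for c :: complex
    by (intro fps_expansion_intros)
  have \<phi>_hol: "\<phi> holomorphic_on ball 0 1"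
  proof -
    have "(eval_fps T \<circ> (\<lambda>z. \<sigma> * z)) holomorphic_on ball 0 1"
      by (rule holomorphic_on_compose_gen[OF _ T(1)]) (auto intro!: holomorphic_intros simp: small)
    then show ?thesis unfolding \<phi>_def[abs_def] o_def by (intro holomorphic_intros)
  qed
  have \<phi>_fps: "\<phi> has_fps_expansion \<Phi>"
  proof -
    have "(eval_fps T \<circ> (\<lambda>z. \<sigma> * z)) has_fps_expansion (T oo (fps_const \<sigma> * fps_X))"
      by (intro has_fps_expansion_compose T lin) simp
    then show ?thesis unfolding \<phi>_def[abs_def] \<Phi>_def o_def by (intro fps_expansion_intros)
  qed
  have \<gamma>_hol: "\<gamma> holomorphic_on ball 0 1"
  proof -
    have "1 - \<sigma> * z \<notin> \<real>\<^sub>\<le>\<^sub>0" if "norm z < 1" for z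
    proof -
      have "Re (\<sigma> * z) < 1" using small[OF that] complex_Re_le_cmod[of "\<sigma> * z"] by linarith
      then show ?thesis by (auto simp: complex_nonpos_Reals_iff)
    qed
    then show ?thesis unfolding \<gamma>_def[abs_def] by (intro holomorphic_intros) auto
  qed
  have \<gamma>_fps: "\<gamma> has_fps_expansion G"
  proof -
    have "((\<lambda>x. (1 + x) powr v) \<circ> (\<lambda>z. - \<sigma> * z)) has_fps_expansion G"
      unfolding G_def by (intro has_fps_expansion_compose has_fps_expansion_binomial_complex lin) simp
    then show ?thesis by (simp add: \<gamma>_def[abs_def] o_def)
  qed
  have \<Phi>_pow: "fps_nth (\<Phi> ^ k) m = \<sigma> ^ (p * k) * (\<sigma> ^ m * fps_nth (T ^ k) m)" for k m
  proof -
    have "\<Phi> ^ k = fps_const ((\<sigma> ^ p) ^ k) * (T ^ k oo (fps_const \<sigma> * fps_X))"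
      unfolding \<Phi>_def power_mult_distrib fps_const_power by (subst fps_compose_power) auto
    then show ?thesis by (simp add: fps_compose_linear power_mult)
  qed
  have G_nth: "fps_nth G j = (-\<sigma>) ^ j * (v gchoose j)" for j
    unfolding G_def fps_compose_linear by simp
  have "laplace_coeff p M \<Phi> G q = log_coeff p \<sigma> M v q" for q
    unfolding laplace_coeff_def log_coeff_def sum_distrib_left
  proof (intro sum.cong refl)
    fix m k assume "m \<in> {..q}"
    then have "(-\<sigma>) ^ q = (-\<sigma>) ^ (q - m) * (-\<sigma>) ^ m" by (simp flip: power_add)
    also have "(-\<sigma>) ^ m = (-1) ^ m * \<sigma> ^ m" by (rule power_minus)
    finally have e: "(-\<sigma>) ^ q = (-\<sigma>) ^ (q - m) * ((-1) ^ m * \<sigma> ^ m)" .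
    have s: "(-1) ^ m * ((-1) ^ m * y) = y" for y :: complex
      by (simp flip: mult.assoc power_mult_distrib)
    show "fps_nth G (q - m) * ((-1) ^ k / fact k * fps_nth (\<Phi> ^ k) m * M (p * k + q)) =
       (-\<sigma>) ^ q * ((-1) ^ m * (v gchoose (q - m)) *
         ((-1) ^ k / fact k * \<sigma> ^ (p * k) * fps_nth (log_tail_fps p ^ k) m * M (p * k + q)))"
      unfolding e G_nth \<Phi>_pow T_def[symmetric]
      by (simp only: mult_ac s)
  qed
  moreover have "(\<lambda>n. (LINT t:D|lborel. exp (of_real n * f t) * g t) -
            (\<Sum>q<Q. laplace_coeff p M \<Phi> G q * of_real (n powr (- (real q + 1) / real p))))
         \<in> O[at_top](\<lambda>n. of_real (n powr (- (real Q + 1) / real p)))"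
  proof (rule laplace_expansion[OF meas _ _ D zero_less_one a \<phi>_hol \<gamma>_hol \<phi>_fps \<gamma>_fps _ _ _ away int moment moment' p])
    show "f \<in> borel_measurable borel" "g \<in> borel_measurable borel"
      unfolding f[abs_def] g[abs_def] by measurable
    show "fps_nth \<Phi> 0 = 0" by (simp add: \<Phi>_def T_def)
    show "f t = - (of_real t ^ p * (a + \<phi> (of_real t)))" if "0 \<le> t" "t < 1" for t
      using log_tail_eq[of "\<sigma> * of_real t" p] small[of "of_real t"] that
      by (simp add: f \<phi>_def T_def algebra_simps)
    show "g t = \<gamma> (of_real t)" for t by (simp add: g \<gamma>_def)
  qed auto
  ultimately show ?thesis by simp
qed

subsection \<open>The integrals on both sides of the saddle point\<close>

text \<open>The modulus of z^v is |z|^(Re v) exp(-Im v arg z), and the principal argument is at most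
  pi in absolute value.\<close>

lemma norm_powr_complex_le:
  assumes "z \<noteq> 0"
  shows "norm (z powr v) \<le> norm z powr Re v * exp (pi * \<bar>Im v\<bar>)"
proof -
  have "- (Im v * Im (Ln z)) \<le> \<bar>Im v\<bar> * \<bar>Im (Ln z)\<bar>"
    by (metis abs_ge_minus_self abs_mult)
  also have "\<dots> \<le> \<bar>Im v\<bar> * pi"
    using assms mpi_less_Im_Ln[of z] Im_Ln_le_pi[of z] by (intro mult_left_mono) auto
  finally show ?thesis
    using assms by (simp add: powr_def exp_add[symmetric] mult_ac)
qed

definition left_phase :: "complex \<Rightarrow> real \<Rightarrow> complex" where
  "left_phase w t = w * of_real t + Ln (1 - of_real t)"

definition left_integral :: "real \<Rightarrow> complex \<Rightarrow> complex \<Rightarrow> complex" where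
  "left_integral n w v =
     (LINT t:{0..<1}|lborel. exp (of_real n * left_phase w t) * (1 - of_real t) powr v)"

text \<open>On the horizontal ray u = w + t, the integrand exp(-n u) u^(n+v) is its value at w times
  exp(n (-t + log(1 + t/w))) (1 + t/w)^v.\<close>

definition right_phase :: "complex \<Rightarrow> real \<Rightarrow> complex" where
  "right_phase w t = - of_real t + Ln (1 + of_real t / w)"

definition right_integral :: "real \<Rightarrow> complex \<Rightarrow> complex \<Rightarrow> complex" where
  "right_integral n w v =
     (LINT t:{0..}|lborel. exp (of_real n * right_phase w t) * (1 + of_real t / w) powr v)"

lemma Ln_one_minus_of_real: "t < 1 \<Longrightarrow> Ln (1 - of_real t) = of_real (ln (1 - t))"
  using Ln_of_real[of "1 - t"] by simp

text \<open>The condition on n gives n + Re v >= 0, so (1 - t)^(n + Re v) stays at most 1 up to the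
  right endpoint; the exponential is at most exp(n |w|).\<close>

lemma left_integrable:
  assumes "n \<ge> norm v"
  shows "set_integrable lborel {0..<1} (\<lambda>t. exp (of_real n * left_phase w t) * (1 - of_real t) powr v)"
proof (rule set_integrable_bound)
  show "set_integrable lborel {0..<1} (\<lambda>t::real. exp (n * norm w))"
    by (simp add: set_integrable_def)
  show "set_borel_measurable lborel {0..<1} (\<lambda>t. exp (of_real n * left_phase w t) * (1 - of_real t) powr v)"
    unfolding set_borel_measurable_def left_phase_def by measurable
  have n: "n \<ge> 0" "n + Re v \<ge> 0"
    using assms abs_Re_le_cmod[of v] norm_ge_zero[of v] by linarith+
  have "norm (exp (of_real n * left_phase w t) * (1 - of_real t) powr v) \<le> norm (exp (n * norm w))"
    if "t \<in> {0..<1}" for t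
  proof -
    have t: "0 \<le> t" "t < 1" using that by auto
    have "Re w * t \<le> norm w * 1"
      using t complex_Re_le_cmod[of w] by (intro mult_mono) auto
    then have "n * (Re w * t) \<le> n * norm w" using n by (intro mult_left_mono) auto
    moreover have "(n + Re v) * ln (1 - t) \<le> 0"
      using n t by (intro mult_nonneg_nonpos) auto
    ultimately have "n * (Re w * t + ln (1 - t)) + Re v * ln (1 - t) \<le> n * norm w"
      by (simp add: algebra_simps)
    moreover have "(1 - complex_of_real t) powr v = exp (v * of_real (ln (1 - t)))"
      using t by (simp add: powr_def Ln_one_minus_of_real)
    ultimately show ?thesis
      using t by (simp add: norm_mult left_phase_def Ln_one_minus_of_real exp_add[symmetric])
  qed
  then show "AE t in lborel. t \<in> {0..<1} \<longrightarrow>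
      norm (exp (of_real n * left_phase w t) * (1 - of_real t) powr v) \<le> norm (exp (n * norm w))"
    by (intro AE_I2) blast
qed

text \<open>Applying log x <= x - 1 to the quotient (1 + t) / (1 + d) gives monotonicity without
  derivatives. The value at d then bounds the phase for all t >= d.\<close>

lemma ln_one_plus_minus_le:
  fixes d t :: real
  assumes "0 < d" "d \<le> t"
  shows "ln (1 + t) - t \<le> ln (1 + d) - d"
proof -
  have "ln ((1 + t) / (1 + d)) \<le> (1 + t) / (1 + d) - 1"
    using assms by (intro ln_le_minus_one) auto
  also have "\<dots> \<le> t - d"
  proof -
    have "(t - d) * 1 \<le> (t - d) * (1 + d)" using assms by (intro mult_left_mono) auto
    then show ?thesis using assms by (simp add: field_simps)
  qed
  finally show ?thesis using assms by (simp add: ln_div)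
qed

lemma ln_one_minus_plus_le:
  fixes d t :: real
  assumes "0 < d" "d \<le> t" "t < 1"
  shows "ln (1 - t) + t \<le> ln (1 - d) + d"
proof -
  have "ln ((1 - t) / (1 - d)) \<le> (1 - t) / (1 - d) - 1"
    using assms by (intro ln_le_minus_one) auto
  also have "\<dots> \<le> d - t"
  proof -
    have "(t - d) * (1 - d) \<le> (t - d) * 1" using assms by (intro mult_left_mono) auto
    then show ?thesis using assms by (simp add: field_simps)
  qed
  finally show ?thesis using assms by (simp add: ln_div)
qed

text \<open>Re w >= 1 forces |w| >= 1, which gives the upper bound, and Re (t / w) >= 0, which gives
  the lower ones. The upper bound compares the phase at w with the phase at 1.\<close>

lemma norm_one_plus_div_bounds:
  assumes "Re w \<ge> 1" "t \<ge> 0"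
  shows "norm (1 + of_real t / w) \<le> 1 + t" "1 \<le> Re (1 + of_real t / w)" "1 \<le> norm (1 + of_real t / w)"
proof -
  have w: "norm w \<ge> 1" using assms(1) complex_Re_le_cmod[of w] by linarith
  have "norm (of_real t / w) \<le> t"
  proof -
    have "t / norm w \<le> t / 1" using w assms(2) by (intro divide_left_mono) auto
    then show ?thesis using assms(2) by (simp add: norm_divide)
  qed
  then show "norm (1 + of_real t / w) \<le> 1 + t"
    using norm_triangle_ineq[of 1 "of_real t / w"] by simp
  have "Re (of_real t / w) = t * Re w / (norm w)\<^sup>2"
    by (simp add: Re_divide cmod_power2)
  then show "1 \<le> Re (1 + of_real t / w)" using assms by simp
  then show "1 \<le> norm (1 + of_real t / w)"
    using complex_Re_le_cmod[of "1 + of_real t / w"] by linarith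
qed

lemma Re_right_phase_le:
  assumes "Re w \<ge> 1" "t \<ge> 0"
  shows "Re (right_phase w t) \<le> ln (1 + t) - t"
proof -
  note b = norm_one_plus_div_bounds[OF assms]
  have "1 + of_real t / w \<noteq> 0" using b(3) by auto
  moreover have "ln (norm (1 + of_real t / w)) \<le> ln (1 + t)"
    using b by (intro ln_mono) auto
  ultimately show ?thesis by (simp add: right_phase_def)
qed

lemma right_phase_away:
  assumes "Re w \<ge> 1" "d > 0"
  shows "\<exists>\<eta>>0. \<forall>t\<in>{0..}. t \<ge> d \<longrightarrow> Re (right_phase w t) \<le> - \<eta>"
proof (intro exI conjI ballI impI)
  show "d - ln (1 + d) > 0"
    using ln_add_one_self_less_self[OF assms(2)] by simp
  show "Re (right_phase w t) \<le> - (d - ln (1 + d))" if "t \<ge> d" for t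
    using Re_right_phase_le[OF assms(1), of t] ln_one_plus_minus_le[OF assms(2) that] assms(2) that by simp
qed

text \<open>By monotonicity in n it suffices to dominate the integrand at n = 1, where exp of the
  logarithm is just one more factor 1 + t / w.\<close>

lemma right_integrable:
  assumes "Re w \<ge> 1" "n \<ge> 1"
  shows "set_integrable lborel {0..} (\<lambda>t. exp (of_real n * right_phase w t) * (1 + of_real t / w) powr v)"
proof (rule set_integrable_exp_phase[where ?n0.0 = 1])
  show "right_phase w \<in> borel_measurable borel" "(\<lambda>t. (1 + of_real t / w) powr v) \<in> borel_measurable borel"
    unfolding right_phase_def[abs_def] by measurable
  show "Re (right_phase w t) \<le> 0" if "t \<in> {0..}" for t
    using Re_right_phase_le[OF assms(1), of t] ln_add_one_self_le_self[of t] that by simp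
  \<comment> \<open>An integer exponent at least 1 + Re v, where the 1 stems from the phase at n =
    1. It bounds the algebraic growth by a multiple of 1 + t^N, so two exponential moments give an
    integrable majorant.\<close>
  define N where "N = Suc (nat \<lceil>norm v\<rceil>)"
  define K where "K = exp (pi * \<bar>Im v\<bar>) * 2 ^ N"
  have Re_le: "Re v \<le> norm v" using abs_Re_le_cmod[of v] by linarith
  have N: "1 + Re v \<le> real N" using Re_le unfolding N_def by linarith
  show "set_integrable lborel {0..} (\<lambda>t. exp (of_real 1 * right_phase w t) * (1 + of_real t / w) powr v)"
  proof (rule set_integrable_bound)
    have "has_bochner_integral lborel (\<lambda>t. K * (indicator {0..} t *\<^sub>R (exp (- (1 * t)) * t ^ 0) +
        indicator {0..} t *\<^sub>R (exp (- (1 * t)) * t ^ N))) (K * (fact 0 / 1 ^ (0 + 1) + fact N / 1 ^ (N + 1)))"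
      by (intro has_bochner_integral_mult_right has_bochner_integral_add exp_moment_real) auto
    moreover have "(\<lambda>t. K * (indicator {0..} t *\<^sub>R (exp (- (1 * t)) * t ^ 0) +
        indicator {0..} t *\<^sub>R (exp (- (1 * t)) * t ^ N))) =
        (\<lambda>t::real. indicator {0..} t *\<^sub>R (K * (exp (- t) * (1 + t ^ N))))"
      by (auto simp: fun_eq_iff algebra_simps)
    ultimately show "set_integrable lborel {0..} (\<lambda>t. K * (exp (- t) * (1 + t ^ N)))"
      unfolding set_integrable_def by (metis (no_types, lifting) integrable.intros)
    show "set_borel_measurable lborel {0..} (\<lambda>t. exp (of_real 1 * right_phase w t) * (1 + of_real t / w) powr v)"
      unfolding set_borel_measurable_def right_phase_def by measurable
    have "norm (exp (of_real 1 * right_phase w t) * (1 + of_real t / w) powr v) \<le> norm (K * (exp (- t) * (1 + t ^ N)))"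
      if "t \<in> {0..}" for t
    proof -
      have t: "t \<ge> 0" using that by simp
      define z where "z = 1 + of_real t / w"
      have z: "norm z \<le> 1 + t" "1 \<le> norm z"
        unfolding z_def using norm_one_plus_div_bounds[OF assms(1) t] by auto
      then have z0: "z \<noteq> 0" by auto
      have "norm (exp (of_real 1 * right_phase w t)) = exp (- t) * norm z"
      proof -
        have "exp (of_real 1 * right_phase w t) = of_real (exp (- t)) * z"
          using z0 unfolding right_phase_def z_def[symmetric] of_real_1 mult_1
          by (simp only: exp_add exp_Ln) (simp add: exp_of_real[symmetric])
        then show ?thesis by (simp add: norm_mult)
      qed
      moreover have "norm (z powr v) \<le> norm z powr Re v * exp (pi * \<bar>Im v\<bar>)"
        by (rule norm_powr_complex_le[OF z0])
      ultimately have "norm (exp (of_real 1 * right_phase w t) * z powr v) \<le>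
          exp (- t) * norm z * (norm z powr Re v * exp (pi * \<bar>Im v\<bar>))"
        unfolding norm_mult by (simp add: mult_left_mono)
      also have "\<dots> = exp (- t) * (norm z powr (1 + Re v)) * exp (pi * \<bar>Im v\<bar>)"
        using z by (simp add: powr_add mult_ac)
      also have "norm z powr (1 + Re v) \<le> norm z powr real N"
        using z N by (intro powr_mono) auto
      also have "\<dots> = norm z ^ N" using z0 by (subst powr_realpow) auto
      also have "\<dots> \<le> (1 + t) ^ N" using z by (intro power_mono) auto
      also have "\<dots> \<le> (2 * max 1 t) ^ N" using t by (intro power_mono) auto
      also have "\<dots> = 2 ^ N * (max 1 t) ^ N" by (simp add: power_mult_distrib)
      also have "(max 1 t) ^ N \<le> 1 + t ^ N" using t by (cases "t \<le> 1") (auto simp: max_def)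
      finally have "norm (exp (of_real 1 * right_phase w t) * z powr v) \<le>
          exp (- t) * (2 ^ N * (1 + t ^ N)) * exp (pi * \<bar>Im v\<bar>)" by simp
      also have "\<dots> = K * (exp (- t) * (1 + t ^ N))" by (simp add: K_def mult_ac)
      finally show ?thesis unfolding z_def by (simp add: abs_le_iff order.trans[OF _ abs_ge_self])
    qed
    then show "AE t in lborel. t \<in> {0..} \<longrightarrow> norm (exp (of_real 1 * right_phase w t) * (1 + of_real t / w) powr v)
        \<le> norm (K * (exp (- t) * (1 + t ^ N)))"
      by (intro AE_I2) blast
  qed
qed (use assms in auto)

text \<open>The substitution is z = 1 - t. The condition on n ensures absolute integrability, which
  makes the gauge integral in \<open>S_fun\<close> agree with the Lebesgue integral.\<close>

lemma S_fun_eq_left_integral: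
  assumes "n \<ge> norm v"
  shows "S_fun n w v = 1 + of_real n * w * left_integral n w v"
proof -
  let ?F = "\<lambda>z::real. exp (of_real n * w * (1 - of_real z)) * of_real z powr (of_real n + v)"
  let ?G = "\<lambda>t::real. exp (of_real n * left_phase w t) * (1 - of_real t) powr v"
  \<comment> \<open>The reflection carries the half-open interval (0,1] to [0,1). The omitted point
    z = 0 is a null set and is restored at the end.\<close>
  have FG: "indicator {0<..1} (1 + (-1) * t) *\<^sub>R ?F (1 + (-1) * t) = indicator {0..<1} t *\<^sub>R ?G t" for t
  proof (cases "t \<in> {0..<1}")
    case True
    then have "complex_of_real (1 - t) \<noteq> 0" by simp
    then have "?F (1 - t) = ?G t"
      by (simp add: powr_def left_phase_def exp_add[symmetric] algebra_simps)
    with True show ?thesis by simp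
  qed (auto split: split_indicator)
  have "has_bochner_integral lborel (\<lambda>t. indicator {0..<1} t *\<^sub>R ?G t) (left_integral n w v)"
    using left_integrable[OF assms, of w]
    by (simp add: has_bochner_integral_iff set_integrable_def left_integral_def set_lebesgue_integral_def)
  then have "has_bochner_integral lborel (\<lambda>t. indicator {0<..1} (1 + (-1) * t) *\<^sub>R ?F (1 + (-1) * t))
      (left_integral n w v /\<^sub>R \<bar>-1\<bar>)"
    unfolding FG by simp
  then have "has_bochner_integral lborel (\<lambda>t. indicator {0<..1} t *\<^sub>R ?F t) (left_integral n w v)"
    by (subst lborel_has_bochner_integral_real_affine_iff[where c="-1" and t=1]) auto
  then have "set_integrable lborel {0<..1} ?F" "(LINT t:{0<..1}|lborel. ?F t) = left_integral n w v"
    by (auto simp: set_integrable_def set_lebesgue_integral_def has_bochner_integral_iff)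
  then have "integral {0<..1} ?F = left_integral n w v"
    by (simp add: set_borel_integral_eq_integral)
  moreover have "integral {0<..1} ?F = integral {0..1} ?F"
  proof (rule integral_spike_set)
    show "negligible {x \<in> {0<..1} - {0..1}. ?F x \<noteq> 0}" by (rule negligible_subset[of "{}"]) auto
    show "negligible {x \<in> {0..1} - {0<..1}. ?F x \<noteq> 0}"
      by (rule negligible_subset[of "{0}"]) auto
  qed
  ultimately show ?thesis by (simp add: S_fun_def)
qed

text \<open>The two sides are \<open>\<integral> e\<^bsup>-nu\<^esup> u\<^bsup>n+v\<^esup> du\<close> along the path from \<open>0\<close> to \<open>w\<close> and on to
  \<open>w + \<infinity>\<close>, and along the positive real axis.\<close>
lemma left_right_integral_contour:
  assumes w: "Re w \<ge> 1" and n: "n \<ge> 1" "n \<ge> norm v"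
  shows "exp (- of_real n * w) * w powr (of_real n + v) * (w * left_integral n w v + right_integral n w v) =
         exp (- of_real n) * (left_integral n 1 v + right_integral n 1 v)"
proof -
  define h where "h u = exp (- of_real n * u) * u powr (of_real n + v)" for u
  define P where "P = {u. Re u > 0}"
  have P: "convex P" "open P"
    unfolding P_def by (auto simp: convex_halfspace_Re_gt open_halfspace_Re_gt)
  have "h holomorphic_on P"
    unfolding h_def P_def by (intro holomorphic_intros) (auto simp: complex_nonpos_Reals_iff)
  \<comment> \<open>Cauchy's theorem is used through a primitive on the convex right half-plane,
    which avoids the cut: integrals along segments become differences of values of H.\<close>
  then obtain H where "\<And>x. x \<in> P \<Longrightarrow> (H has_field_derivative h x) (at x within P)"
    using holomorphic_convex_primitive'[OF P] by blast
  then have H: "(H has_field_derivative h x) (at x)" if "Re x > 0" for x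
    using that P(2) unfolding P_def by (metis (mono_tags, lifting) at_within_open mem_Collect_eq)
  have h_cont: "continuous_on P h"
    using \<open>h holomorphic_on P\<close> by (rule holomorphic_on_imp_continuous_on)
  \<comment> \<open>The integral of h along the path from 0 through w to w + infinity; the claim
    becomes \<open>A w = A 1\<close>.\<close>
  define A where "A w = exp (- of_real n * w) * w powr (of_real n + v) * (w * left_integral n w v + right_integral n w v)" for w
  \<comment> \<open>H is not defined by an integral from 0, and its limits at 0 and infinity are
    unknown. Both ends of the path are therefore approached along sequences, which are later
    compared with those for w = 1.\<close>
  have path: "(\<lambda>i. H (w + of_real (real i)) - H (w * of_real (1 / real (Suc i)))) \<longlonglongrightarrow> A w" if w: "Re w \<ge> 1" for w
  proof -
    define c where "c = exp (- of_real n * w) * w powr (of_real n + v)"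
    have w0: "w \<noteq> 0" using w by auto
    have left: "(\<lambda>i. - H (w * of_real (1 - (1 - 1 / real (Suc i)))) - - H (w * of_real (1 - 0))) \<longlonglongrightarrow>
        (LINT t:{0..<1}|lborel. (c * w) * (exp (of_real n * left_phase w t) * (1 - of_real t) powr v))"
    proof (rule set_integral_FTC_tendsto[where F = "\<lambda>t. - H (w * of_real (1 - t))" and u = "\<lambda>i. 1 - 1 / real (Suc i)"])
      show "set_integrable lborel {0..<1} (\<lambda>t. (c * w) * (exp (of_real n * left_phase w t) * (1 - of_real t) powr v))"
        by (intro set_integrable_mult_right left_integrable n)
      show "{0..<1} = (\<Union>i. {0..1 - 1 / real (Suc i)})"
      proof (intro equalityI subsetI)
        fix t :: real assume t: "t \<in> {0..<1}"
        then obtain i where "inverse (real (Suc i)) < 1 - t"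
          using reals_Archimedean[of "1 - t"] by auto
        with t show "t \<in> (\<Union>i. {0..1 - 1 / real (Suc i)})"
          by (intro UN_I[of i]) (auto simp: inverse_eq_divide)
      next
        fix t :: real assume "t \<in> (\<Union>i. {0..1 - 1 / real (Suc i)})"
        then obtain i where "0 \<le> t" "t \<le> 1 - 1 / real (Suc i)" by auto
        moreover have "1 / real (Suc i) > 0" by simp
        ultimately show "t \<in> {0..<1}" unfolding atLeastLessThan_iff by linarith
      qed
      show "mono (\<lambda>i. 1 - 1 / real (Suc i))"
        by (auto simp: mono_def frac_le)
      show "0 \<le> 1 - 1 / real (Suc i)" for i by simp
      have eq: "(c * w) * (exp (of_real n * left_phase w t) * (1 - of_real t) powr v) = w * h (w * of_real (1 - t))"
        if "t \<in> {0..<1}" for t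
      proof -
        have "Ln (w * of_real (1 - t)) = Ln w + Ln (1 - of_real t)"
          using that w0 Ln_times_of_real[of "1 - t" w] by (simp add: Ln_one_minus_of_real mult.commute)
        moreover have "1 - complex_of_real t \<noteq> 0" using that by (auto simp: complex_eq_iff)
        ultimately show ?thesis
          using w0 by (simp add: c_def h_def powr_def left_phase_def exp_add[symmetric] algebra_simps)
      qed
      have pos: "Re (w * of_real (1 - t)) > 0" if "t \<in> {0..<1}" for t
        using w that by simp
      show "((\<lambda>t. - H (w * of_real (1 - t))) has_vector_derivative
          (c * w) * (exp (of_real n * left_phase w t) * (1 - of_real t) powr v)) (at t)" if t: "t \<in> {0..<1}" for t
      proof -
        have "((\<lambda>z. - H (w * (1 - z))) has_field_derivative w * h (w * of_real (1 - t))) (at (of_real t))"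
          using H[OF pos[OF t]] by (auto intro!: derivative_eq_intros DERIV_chain2[where f = H])
        then have "((\<lambda>t. - H (w * (1 - of_real t))) has_vector_derivative w * h (w * of_real (1 - t))) (at t)"
          by (rule has_vector_derivative_real_field)
        then show ?thesis unfolding eq[OF t] by simp
      qed
      have "continuous_on {0..<1} (\<lambda>t. w * h (w * of_real (1 - t)))"
        using pos by (intro continuous_intros continuous_on_compose2[OF h_cont]) (auto simp: P_def)
      then show "continuous_on {0..<1} (\<lambda>t. (c * w) * (exp (of_real n * left_phase w t) * (1 - of_real t) powr v))"
        by (rule continuous_on_cong[THEN iffD1, rotated 2]) (simp_all only: eq)
    qed
    have right: "(\<lambda>i. H (w + of_real (real i)) - H (w + of_real 0)) \<longlonglongrightarrow>
        (LINT t:{0..}|lborel. c * (exp (of_real n * right_phase w t) * (1 + of_real t / w) powr v))"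
    proof (rule set_integral_FTC_tendsto[OF _ Ici_eq_UN_Icc_nat])
      show "set_integrable lborel {0..} (\<lambda>t. c * (exp (of_real n * right_phase w t) * (1 + of_real t / w) powr v))"
        by (intro set_integrable_mult_right right_integrable n w)
      have eq: "c * (exp (of_real n * right_phase w t) * (1 + of_real t / w) powr v) = h (w + of_real t)"
        if "t \<in> {0..}" for t
      proof -
        have t: "t \<ge> 0" using that by simp
        define z where "z = 1 + of_real t / w"
        have z: "Re z > 0" "z \<noteq> 0" using norm_one_plus_div_bounds[OF w t] by (auto simp: z_def)
        \<comment> \<open>Both arguments lie strictly between -pi/2 and pi/2, so their sum stays
          within the principal branch and the logarithm of the product splits.\<close>
        have "\<bar>Im (Ln z)\<bar> < pi / 2" "\<bar>Im (Ln w)\<bar> < pi / 2"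
          using z w w0 Re_Ln_pos_lt[of z] Re_Ln_pos_lt[of w] by linarith+
        then have "Ln (w * z) = Ln w + Ln z"
          using z w0 by (intro Ln_times_simple) auto
        moreover have "w * z = w + of_real t" using w0 by (simp add: z_def field_simps)
        ultimately have "Ln (w + of_real t) = Ln w + Ln z" by simp
        moreover have "w + of_real t \<noteq> 0" using w t by (auto simp: complex_eq_iff)
        ultimately show ?thesis
          using w0 z unfolding right_phase_def z_def[symmetric]
          by (simp add: c_def h_def powr_def exp_add[symmetric] algebra_simps)
      qed
      have pos: "Re (w + of_real t) > 0" if "t \<in> {0..}" for t
        using w that by simp
      show "((\<lambda>t. H (w + of_real t)) has_vector_derivative
          c * (exp (of_real n * right_phase w t) * (1 + of_real t / w) powr v)) (at t)" if t: "t \<in> {0..}" for t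
      proof -
        have "((\<lambda>z. H (w + z)) has_field_derivative h (w + of_real t)) (at (of_real t))"
        proof -
          have "((\<lambda>z. w + z) has_field_derivative 1) (at (of_real t))"
            by (auto intro!: derivative_eq_intros)
          from DERIV_chain2[OF H[OF pos[OF t]] this] show ?thesis by simp
        qed
        then show ?thesis unfolding eq[OF t] by (rule has_vector_derivative_real_field)
      qed
      have "continuous_on {0..} (\<lambda>t. h (w + of_real t))"
        using pos by (intro continuous_intros continuous_on_compose2[OF h_cont]) (auto simp: P_def)
      then show "continuous_on {0..} (\<lambda>t. c * (exp (of_real n * right_phase w t) * (1 + of_real t / w) powr v))"
        by (rule continuous_on_cong[THEN iffD1, rotated 2]) (simp_all only: eq)
    qed (auto simp: mono_def)
    have "(LINT t:{0..<1}|lborel. (c * w) * (exp (of_real n * left_phase w t) * (1 - of_real t) powr v)) +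
        (LINT t:{0..}|lborel. c * (exp (of_real n * right_phase w t) * (1 + of_real t / w) powr v)) = A w"
      by (simp only: set_integral_mult_right left_integral_def[symmetric] right_integral_def[symmetric])
        (simp add: A_def c_def algebra_simps)
    with tendsto_add[OF left right] show ?thesis by (simp add: algebra_simps)
  qed
  have h_le: "norm (h u) \<le> exp (- n * Re u) * (norm u powr (n + Re v) * exp (pi * \<bar>Im v\<bar>))" if "Re u > 0" for u
  proof -
    have "u \<noteq> 0" using that by auto
    from norm_powr_complex_le[OF this, of "of_real n + v"] show ?thesis
      unfolding h_def norm_mult by (simp add: mult_left_mono)
  qed
  have nv: "n + Re v \<ge> 0" using n abs_Re_le_cmod[of v] by linarith
  have w1: "norm w \<ge> 1" using w complex_Re_le_cmod[of w] by linarith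
  \<comment> \<open>Near 0 the integrand is bounded because n + Re v >= 0, and the segment joining
    the two starting points has length |w - 1| / (i + 1).\<close>
  have lim0: "(\<lambda>i. H (w * of_real (1 / real (Suc i))) - H (1 * of_real (1 / real (Suc i)))) \<longlonglongrightarrow> 0"
  proof (rule tendsto_0_le[where K = 1])
    define C where "C = norm w powr (n + Re v) * exp (pi * \<bar>Im v\<bar>)"
    show "(\<lambda>i. C * norm (w - 1) * (1 / real (Suc i))) \<longlonglongrightarrow> 0"
      using tendsto_mult_right_zero[OF LIMSEQ_inverse_real_of_nat] by (simp add: inverse_eq_divide)
    have "norm (H (w * of_real (1 / real (Suc i))) - H (1 * of_real (1 / real (Suc i)))) \<le>
        C * norm (w - 1) * (1 / real (Suc i))" for i
    proof -
      define e where "e = 1 / real (Suc i)"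
      have e: "0 < e" "e \<le> 1" by (auto simp: e_def)
      have "norm (H (w * of_real e) - H (1 * of_real e)) \<le> C * norm (w * of_real e - 1 * of_real e)"
      proof (rule field_differentiable_bound[where S = "P \<inter> cball 0 (norm w)" and f' = h])
        show "convex (P \<inter> cball 0 (norm w))" using P by (intro convex_Int) auto
        show "(H has_field_derivative h z) (at z within P \<inter> cball 0 (norm w))" if "z \<in> P \<inter> cball 0 (norm w)" for z
          using that H[of z] by (auto simp: P_def intro: has_field_derivative_at_within)
        show "norm (h z) \<le> C" if "z \<in> P \<inter> cball 0 (norm w)" for z
        proof -
          have z: "Re z > 0" "norm z \<le> norm w" using that by (auto simp: P_def)
          have "exp (- n * Re z) \<le> 1" using z n by simp
          moreover have "norm z powr (n + Re v) \<le> norm w powr (n + Re v)"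
            using z nv by (intro powr_mono2) auto
          ultimately have "exp (- n * Re z) * (norm z powr (n + Re v) * exp (pi * \<bar>Im v\<bar>)) \<le> 1 * C"
            unfolding C_def by (intro mult_mono) auto
          with h_le[OF z(1)] show ?thesis by simp
        qed
        have "norm w * e \<le> norm w * 1" using e by (intro mult_left_mono) auto
        then show "w * of_real e \<in> P \<inter> cball 0 (norm w)"
          using e w by (simp add: P_def norm_mult)
        show "1 * of_real e \<in> P \<inter> cball 0 (norm w)" using e w1 by (simp add: P_def)
      qed
      also have "w * of_real e - 1 * of_real e = (w - 1) * of_real e" by (simp add: algebra_simps)
      also have "norm \<dots> = norm (w - 1) * e" using e by (simp add: norm_mult)
      finally show ?thesis by (simp add: e_def)
    qed
    then show "\<forall>\<^sub>F i in sequentially. norm (H (w * of_real (1 / real (Suc i))) - H (1 * of_real (1 / real (Suc i)))) \<le>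
        norm (C * norm (w - 1) * (1 / real (Suc i))) * 1"
      unfolding mult_1_right real_norm_def
      by (intro always_eventually allI order.trans[OF _ abs_ge_self])
  qed
  \<comment> \<open>The segment joining the two far ends has fixed length |w - 1| and lies in Re u
    >= 1 + i, where the exponential factor beats the power.\<close>
  have lim_inf: "(\<lambda>i. H (w + of_real (real i)) - H (1 + of_real (real i))) \<longlonglongrightarrow> 0"
  proof (rule tendsto_0_le[where K = 1])
    define C where "C x = exp (- n * x) * ((x + norm w) powr (n + Re v) * exp (pi * \<bar>Im v\<bar>))" for x
    have "n > 0" using n by simp
    have "((\<lambda>x. exp (- n * x) * ((x + W) powr s * E) * D) \<longlongrightarrow> 0) at_top" for W s E D :: real
      using \<open>n > 0\<close> by real_asymp
    then have "((\<lambda>x. C x * norm (w - 1)) \<longlongrightarrow> 0) at_top" unfolding C_def .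
    then show "(\<lambda>i. C (real i) * norm (w - 1)) \<longlonglongrightarrow> 0"
      by (rule filterlim_compose) (rule filterlim_real_sequentially)
    have "norm (H (w + of_real (real i)) - H (1 + of_real (real i))) \<le> C (real i) * norm (w - 1)" for i
    proof -
      define x where "x = real i"
      have x: "x \<ge> 0" by (simp add: x_def)
      let ?S = "{u. Re u \<ge> 1 + x} \<inter> cball 0 (x + norm w)"
      have "norm (H (w + of_real x) - H (1 + of_real x)) \<le> C x * norm ((w + of_real x) - (1 + of_real x))"
      proof (rule field_differentiable_bound[where S = ?S and f' = h])
        show "convex ?S" by (intro convex_Int convex_halfspace_Re_ge) auto
        show "(H has_field_derivative h z) (at z within ?S)" if "z \<in> ?S" for z
          using that H[of z] x by (auto intro: has_field_derivative_at_within)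
        show "norm (h z) \<le> C x" if "z \<in> ?S" for z
        proof -
          have z: "Re z \<ge> 1 + x" "norm z \<le> x + norm w" using that by auto
          have "n * x \<le> n * Re z" using z n by (intro mult_left_mono) auto
          then have "exp (- n * Re z) \<le> exp (- n * x)" by simp
          moreover have "norm z powr (n + Re v) \<le> (x + norm w) powr (n + Re v)"
            using z nv by (intro powr_mono2) auto
          ultimately have "exp (- n * Re z) * (norm z powr (n + Re v) * exp (pi * \<bar>Im v\<bar>)) \<le> C x"
            unfolding C_def by (intro mult_mono mult_right_mono) auto
          with h_le[of z] z x show ?thesis by simp
        qed
        show "w + of_real x \<in> ?S"
          using w x norm_triangle_ineq[of w "of_real x"] by simp
        show "1 + of_real x \<in> ?S"
          using w1 x norm_triangle_ineq[of 1 "complex_of_real x"] by simp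
      qed
      then show ?thesis by (simp add: x_def)
    qed
    then show "\<forall>\<^sub>F i in sequentially. norm (H (w + of_real (real i)) - H (1 + of_real (real i))) \<le>
        norm (C (real i) * norm (w - 1)) * 1"
      unfolding mult_1_right real_norm_def
      by (intro always_eventually allI order.trans[OF _ abs_ge_self])
  qed
  have "(\<lambda>i. (H (w + of_real (real i)) - H (w * of_real (1 / real (Suc i)))) -
       (H (1 + of_real (real i)) - H (1 * of_real (1 / real (Suc i))))) \<longlonglongrightarrow> A w - A 1"
    by (intro tendsto_diff path w) simp
  moreover have "(\<lambda>i. (H (w + of_real (real i)) - H (w * of_real (1 / real (Suc i)))) -
       (H (1 + of_real (real i)) - H (1 * of_real (1 / real (Suc i))))) \<longlonglongrightarrow> 0"
    using tendsto_diff[OF lim_inf lim0] by (simp add: algebra_simps)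
  ultimately have "A w - A 1 = 0" using LIMSEQ_unique by blast
  then show ?thesis by (simp add: A_def)
qed

subsection \<open>Expansions of the integrals\<close>

lemma bigo_of_real_iff:
  "(\<lambda>x. complex_of_real (h x)) \<in> O[F](\<lambda>x. of_real (k x)) \<longleftrightarrow> h \<in> O[F](k)"
  by (simp add: bigo_def)

text \<open>The comparison functions are real functions under \<open>of_real\<close>, so the third
  premise is a purely real estimate within reach of \<open>real_asymp\<close>.\<close>

lemma bigo_mult_of_real:
  assumes "f \<in> O[F](\<lambda>x. complex_of_real (h x))" "g \<in> O[F](\<lambda>x. of_real (k x))"
    and "(\<lambda>x. h x * k x) \<in> O[F](l)"
  shows "(\<lambda>x. f x * g x) \<in> O[F](\<lambda>x. of_real (l x))"
proof -
  have "(\<lambda>x. f x * g x) \<in> O[F](\<lambda>x. of_real (h x * k x))"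
    using landau_o.big.mult[OF assms(1,2)] by simp
  also have "(\<lambda>x. complex_of_real (h x * k x)) \<in> O[F](\<lambda>x. of_real (l x))"
    using assms(3) by (simp only: bigo_of_real_iff)
  finally show ?thesis .
qed

lemma bigo_of_real_trans:
  assumes "f \<in> O[F](\<lambda>x. complex_of_real (h x))" "h \<in> O[F](l)"
  shows "f \<in> O[F](\<lambda>x. of_real (l x))"
  using assms(1) by (rule landau_o.big_trans) (use assms(2) in \<open>simp only: bigo_of_real_iff\<close>)

lemma powr_neg_Suc_div_1: "n > 0 \<Longrightarrow> n powr (- (real s + 1) / real 1) = 1 / n ^ (s + 1)"
proof -
  assume "n > 0"
  have "- (real s + 1) / real 1 = - real (s + 1)" by simp
  then show ?thesis
    using \<open>n > 0\<close> by (simp only: powr_minus powr_realpow inverse_eq_divide)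
qed

lemma exp_moment_scaled:
  assumes "Re a > 0" "n > 0"
  shows "has_bochner_integral lborel
        (\<lambda>t. indicator {0..} t *\<^sub>R (exp (- (of_real n * a * of_real t ^ 1)) * of_real t ^ s))
        (fact s / a ^ (s + 1) * of_real (n powr (- (real s + 1) / real 1)))"
  using exp_moment[of "of_real n * a" s] assms
  by (simp only: powr_neg_Suc_div_1) (simp add: power_mult_distrib field_simps)

lemma exp_moment_real_scaled:
  fixes b :: real
  assumes "b > 0"
  shows "\<exists>C. \<forall>n>0. has_bochner_integral lborel
        (\<lambda>t. indicator {0..} t *\<^sub>R (exp (- (n * b * t ^ 1)) * t ^ s))
        (C * n powr (- (real s + 1) / real 1))"
proof (intro exI allI impI)
  fix n :: real assume "n > 0"
  then show "has_bochner_integral lborel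
        (\<lambda>t. indicator {0..} t *\<^sub>R (exp (- (n * b * t ^ 1)) * t ^ s))
        (fact s / b ^ (s + 1) * n powr (- (real s + 1) / real 1))"
    using exp_moment_real[of "n * b" s] assms
    by (simp only: powr_neg_Suc_div_1) (simp add: power_mult_distrib field_simps)
qed

text \<open>Splitting w t + log(1 - t) as -(1 - w) t + (log(1 - t) + t) gives p = 1, \<sigma> = 1
  and rate 1 - w. Since log(1 - t) <= -t, the real part of the phase is at most -(1 - Re w)
  t.\<close>

lemma left_expansion:
  assumes "Re w < 1"
  shows "(\<lambda>n. left_integral n w v - (\<Sum>q<Q. log_coeff 1 1 (\<lambda>s. fact s / (1 - w) ^ (s + 1)) v q *
            of_real (n powr (- (real q + 1) / real 1))))
         \<in> O[at_top](\<lambda>n. of_real (n powr (- (real Q + 1) / real 1)))"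
  unfolding left_integral_def
proof (rule log_phase_expansion)
  show "Re (1 - w) > 0" using assms by simp
  show "left_phase w t = - ((1 - w) * of_real t ^ 1) + Ln (1 - 1 * of_real t) +
      (\<Sum>i=1..1. (1 * of_real t) ^ i / of_nat i)" for t
    by (simp add: left_phase_def algebra_simps)
  show "\<exists>\<eta>>0. \<forall>t\<in>{0..<1}. t \<ge> d \<longrightarrow> Re (left_phase w t) \<le> -\<eta>" if d: "d > 0" for d
  proof (intro exI[of _ "(1 - Re w) * d"] conjI ballI impI)
    show "(1 - Re w) * d > 0" using d assms by simp
    fix t :: real assume t: "t \<in> {0..<1}" "t \<ge> d"
    have "ln (1 - t) \<le> - t" using t ln_le_minus_one[of "1 - t"] by simp
    moreover have "(1 - Re w) * d \<le> (1 - Re w) * t" using t assms by (intro mult_left_mono) auto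
    ultimately show "Re (left_phase w t) \<le> - ((1 - Re w) * d)"
      using t by (simp add: left_phase_def Ln_one_minus_of_real algebra_simps)
  qed
  show "set_integrable lborel {0..<1} (\<lambda>t. exp (of_real (norm v) * left_phase w t) * (1 - of_real t) powr v)"
    by (rule left_integrable) simp
  show "\<exists>C. \<forall>n>0. has_bochner_integral lborel
        (\<lambda>t. indicator {0..} t *\<^sub>R (exp (- (n * b * t ^ 1)) * t ^ Q))
        (C * n powr (- (real Q + 1) / real 1))" if "b > 0" for b
    using that by (rule exp_moment_real_scaled)
  show "has_bochner_integral lborel
        (\<lambda>t. indicator {0..} t *\<^sub>R (exp (- (of_real n * (1 - w) * of_real t ^ 1)) * of_real t ^ s))
        (fact s / (1 - w) ^ (s + 1) * of_real (n powr (- (real s + 1) / real 1)))" if "n > 0" for n s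
    using assms that by (intro exp_moment_scaled) auto
qed auto

text \<open>Here p = 1, \<sigma> = -1/w and the rate is 1 - 1/w: the linear part of log(1 + t/w)
  joins -t.\<close>

lemma right_expansion:
  assumes "Re w \<ge> 1" "w \<noteq> 1"
  shows "(\<lambda>n. right_integral n w v -
            (\<Sum>q<Q. log_coeff 1 (- 1 / w) (\<lambda>s. fact s / (1 - 1 / w) ^ (s + 1)) v q *
            of_real (n powr (- (real q + 1) / real 1))))
         \<in> O[at_top](\<lambda>n. of_real (n powr (- (real Q + 1) / real 1)))"
  unfolding right_integral_def
proof (rule log_phase_expansion)
  have w: "norm w \<ge> 1" using assms(1) complex_Re_le_cmod[of w] by linarith
  show "norm (- 1 / w) \<le> 1" using w by (simp add: norm_divide divide_le_eq_1)
  \<comment> \<open>Since Re (1/w) = Re w / |w|^2, the claim is Re w < |w|^2. On the line Re w = 1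
    strictness comes from Im w being nonzero.\<close>
  show a: "Re (1 - 1 / w) > 0"
  proof -
    have "Re w < (Re w)\<^sup>2 + (Im w)\<^sup>2"
    proof (cases "Re w = 1")
      case True
      with assms(2) have "Im w \<noteq> 0" by (auto simp: complex_eq_iff)
      with True show ?thesis by simp
    next
      case False
      with assms(1) have "Re w > 1" by simp
      then have "Re w < (Re w)\<^sup>2" by (simp add: power2_eq_square)
      then show ?thesis by (simp add: add_strict_increasing2 add.commute)
    qed
    moreover from this have "0 < (Re w)\<^sup>2 + (Im w)\<^sup>2" using assms(1) by linarith
    ultimately show ?thesis by (simp add: Re_divide)
  qed
  show "right_phase w t = - ((1 - 1 / w) * of_real t ^ 1) + Ln (1 - (- 1 / w) * of_real t) +
      (\<Sum>i=1..1. ((- 1 / w) * of_real t) ^ i / of_nat i)" for t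
    by (simp add: right_phase_def algebra_simps)
  show "(1 + of_real t / w) powr v = (1 - (- 1 / w) * of_real t) powr v" for t by simp
  show "\<exists>\<eta>>0. \<forall>t\<in>{0..}. t \<ge> d \<longrightarrow> Re (right_phase w t) \<le> -\<eta>" if "d > 0" for d
    by (rule right_phase_away[OF assms(1) that])
  show "set_integrable lborel {0..} (\<lambda>t. exp (of_real 1 * right_phase w t) * (1 + of_real t / w) powr v)"
    by (rule right_integrable[OF assms(1)]) simp
  show "\<exists>C. \<forall>n>0. has_bochner_integral lborel
        (\<lambda>t. indicator {0..} t *\<^sub>R (exp (- (n * b * t ^ 1)) * t ^ Q))
        (C * n powr (- (real Q + 1) / real 1))" if "b > 0" for b
    using that by (rule exp_moment_real_scaled)
  show "has_bochner_integral lborel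
        (\<lambda>t. indicator {0..} t *\<^sub>R (exp (- (of_real n * (1 - 1 / w) * of_real t ^ 1)) * of_real t ^ s))
        (fact s / (1 - 1 / w) ^ (s + 1) * of_real (n powr (- (real s + 1) / real 1)))" if "n > 0" for n s
    using a that by (rule exp_moment_scaled)
qed auto

section \<open>Identification of the endpoint coefficients with \<open>U\<close>\<close>

lemma deMoivre_seq2: "deMoivre m k seq2 = fps_nth (log_tail_fps 1 ^ k) m"
  unfolding deMoivre_def seq2_def log_tail_fps_def ..

lemma deMoivre_seq3: "deMoivre m k seq3 = fps_nth (log_tail_fps 2 ^ k) m"
  unfolding deMoivre_def seq3_def log_tail_fps_def ..

text \<open>Rewriting powers of 1 - w through w - 1 gives the sign (-1)^(k+r+1); combined with
  (-1)^r and (-1)^k it leaves one overall minus. The Kronecker delta accounts for the summand 1 in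
  S_n.\<close>

lemma log_coeff_left_eq_U:
  "w * log_coeff 1 1 (\<lambda>s. fact s / (1 - w) ^ (s + 1)) v r = U r w v - (if r = 0 then 1 else 0)"
proof -
  have "w * ((- 1) ^ r * ((- 1) ^ m * g * ((- 1) ^ k / fact k * 1 ^ (1 * k) * T * (fact (1 * k + r) / (1 - w) ^ (1 * k + r + 1))))) =
        - ((- 1) ^ m * g * (w / (w - 1) ^ (r + k + 1) * fact (r + k) / fact k * T))" for m k g T
  proof -
    have "(1 - w) ^ (1 * k + r + 1) = (- 1) ^ (k + r + 1) * (w - 1) ^ (r + k + 1)"
      by (metis add.commute minus_diff_eq mult_1 power_minus)
    moreover have "(- 1) ^ r * (- 1) ^ k / (- 1) ^ (k + r + 1) = (-1 :: complex)"
      by (simp add: power_add)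
    ultimately show ?thesis
      by (simp add: power_add add.commute mult_ac)
  qed
  then show ?thesis
    unfolding log_coeff_def U_def deMoivre_seq2 sum_distrib_left atLeast0AtMost
    by (simp add: sum_negf[symmetric] del: power_one)
qed

text \<open>Since 1 - 1/w = (w - 1)/w, the moment contributes w^(r+k+1), of which \<sigma> cancels
  w^r and w^k. The remaining factor w is why both sides of the saddle produce the same
  coefficients.\<close>

lemma log_coeff_right_eq_U:
  assumes "w \<noteq> 0"
  shows "- 1 * log_coeff 1 (- 1 / w) (\<lambda>s. fact s / (1 - 1 / w) ^ (s + 1)) v r = U r w v - (if r = 0 then 1 else 0)"
proof -
  have "- 1 * ((- (- 1 / w)) ^ r * ((- 1) ^ m * g * ((- 1) ^ k / fact k * (- 1 / w) ^ (1 * k) * T * (fact (1 * k + r) / (1 - 1 / w) ^ (1 * k + r + 1))))) =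
        - ((- 1) ^ m * g * (w / (w - 1) ^ (r + k + 1) * fact (r + k) / fact k * T))" for m k g T
  proof -
    have "1 - 1 / w = (w - 1) / w" using assms by (simp add: field_simps)
    then have "(1 - 1 / w) ^ (1 * k + r + 1) = (w - 1) ^ (r + k + 1) / (w ^ r * w ^ k * w)"
      by (simp add: power_divide power_add mult_ac)
    moreover have "(- (- 1 / w)) ^ r = 1 / w ^ r" by (simp add: power_divide)
    moreover have "(- 1) ^ k * (- 1 / w) ^ (1 * k) = 1 / w ^ k"
      by (simp add: power_mult_distrib[symmetric] power_one_over)
    ultimately show ?thesis
      using assms by (simp add: add.commute mult_ac)
  qed
  then show ?thesis
    unfolding log_coeff_def U_def deMoivre_seq2 sum_distrib_left atLeast0AtMost
    by (simp add: sum_negf[symmetric])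
qed

text \<open>Stated for a general integral so that it serves the left one with \<kappa> = w and the
  right one with \<kappa> = -1. The factor n turns n^(-(q+1)) into n^(-q), and the summand 1
  supplies the delta.\<close>

lemma U_expansion:
  fixes I :: "real \<Rightarrow> complex" and c :: "nat \<Rightarrow> complex"
  assumes I: "(\<lambda>n. I n - (\<Sum>q<R. c q * of_real (n powr (- (real q + 1) / real 1))))
         \<in> O[at_top](\<lambda>n. of_real (n powr (- (real R + 1) / real 1)))"
    and c: "\<And>q. \<kappa> * c q = U q w v - (if q = 0 then 1 else 0)" and R: "R \<ge> 1"
  shows "(\<lambda>n. 1 + of_real n * \<kappa> * I n - (\<Sum>r<R. U r w v / of_real n ^ r)) \<in> O[at_top](\<lambda>n. of_real (1 / n ^ R))"
proof -
  let ?E = "\<lambda>n. I n - (\<Sum>q<R. c q * of_real (n powr (- (real q + 1) / real 1)))"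
  have "(\<lambda>n. \<kappa> * of_real n * ?E n) \<in> O[at_top](\<lambda>n. of_real (1 / n ^ R))"
  proof (rule bigo_mult_of_real[OF _ I])
    show "(\<lambda>n. \<kappa> * of_real n) \<in> O[at_top](\<lambda>n. complex_of_real n)" by simp
    have "eventually (\<lambda>n::real. n * n powr (- (real R + 1) / real 1) = 1 / n ^ R) at_top"
      using eventually_gt_at_top[of 0] by eventually_elim (simp only: powr_neg_Suc_div_1, simp)
    then show "(\<lambda>n. n * n powr (- (real R + 1) / real 1)) \<in> O[at_top](\<lambda>n. 1 / n ^ R)"
      by (rule landau_o.big.in_cong[THEN iffD2]) simp
  qed
  moreover have "eventually (\<lambda>n. \<kappa> * of_real n * ?E n =
      1 + of_real n * \<kappa> * I n - (\<Sum>r<R. U r w v / of_real n ^ r)) at_top"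
    using eventually_gt_at_top[of 0]
  proof eventually_elim
    case (elim n)
    have "\<kappa> * of_real n * (\<Sum>q<R. c q * of_real (n powr (- (real q + 1) / real 1))) =
        (\<Sum>q<R. (\<kappa> * c q) / of_real n ^ q)"
      unfolding sum_distrib_left
      by (intro sum.cong refl) (use elim in \<open>simp only: powr_neg_Suc_div_1, simp add: field_simps\<close>)
    also have "\<dots> = (\<Sum>q<R. U q w v / of_real n ^ q) - (\<Sum>q<R. if q = 0 then 1 else 0)"
      unfolding c sum_subtractf[symmetric] by (intro sum.cong refl) (auto simp: diff_divide_distrib)
    also have "(\<Sum>q<R. if q = 0 then 1 else 0) = (1 :: complex)"
      using R by (simp add: sum.delta)
    finally show ?case by (simp add: algebra_simps)
  qed
  ultimately show ?thesis by (rule landau_o.big.in_cong[THEN iffD1, rotated])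
qed

section \<open>Double factorials and half-range Gaussian moments\<close>

lemma dfact_add_2:
  assumes "m \<ge> -1"
  shows "dfact (m + 2) = (m + 2) * dfact m"
proof (cases "m \<le> 0")
  case True
  with assms have "m = -1 \<or> m = 0" by auto
  moreover have I: "{0..<1} = {0::int}" by auto
  have "dfact 1 = 1" "dfact 2 = 2" "dfact 0 = 1" "dfact (-1) = 1"
    by (simp_all add: dfact_def I)
  ultimately show ?thesis by (elim disjE) simp_all
next
  case False
  let ?A = "{0..<(m + 1) div 2}"
  have "{0..<(m + 2 + 1) div 2} = insert 0 ((+) 1 ` ?A)"
    using False by (subst image_add_atLeastLessThan) auto
  then have "(\<Prod>i\<in>{0..<(m + 2 + 1) div 2}. m + 2 - 2 * i) = (\<Prod>i\<in>insert 0 ((+) 1 ` ?A). m + 2 - 2 * i)"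
    by (simp only:)
  also have "\<dots> = (m + 2 - 2 * 0) * (\<Prod>i\<in>(+) 1 ` ?A. m + 2 - 2 * i)"
    by (rule prod.insert) auto
  also have "(\<Prod>i\<in>(+) 1 ` ?A. m + 2 - 2 * i) = (\<Prod>i\<in>?A. m - 2 * i)"
    by (subst prod.reindex) (auto intro!: prod.cong)
  finally have "(\<Prod>i\<in>{0..<(m + 2 + 1) div 2}. m + 2 - 2 * i) = (m + 2) * (\<Prod>i\<in>?A. m - 2 * i)"
    by simp
  with False show ?thesis by (simp add: dfact_def)
qed

lemma dfact_even: "dfact (2 * int p) = 2 ^ p * fact p"
proof (induction p)
  case (Suc p)
  then show ?case using dfact_add_2[of "2 * int p"] by (simp add: algebra_simps)
qed (simp add: dfact_def)

text \<open>The multiplicative form of (2p-1)!! = (2p)! / (2^p p!) keeps the induction within the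
  integers. At p = 0 it rests on (-1)!! = 1.\<close>

lemma dfact_odd: "dfact (2 * int p - 1) * (2 ^ p * fact p) = fact (2 * p)"
proof (induction p)
  case (Suc p)
  have "dfact (2 * int (Suc p) - 1) = (2 * int p + 1) * dfact (2 * int p - 1)"
    using dfact_add_2[of "2 * int p - 1"] by (simp add: algebra_simps)
  then have "dfact (2 * int (Suc p) - 1) * (2 ^ Suc p * fact (Suc p)) =
     (2 * int p + 1) * (2 * int p + 2) * (dfact (2 * int p - 1) * (2 ^ p * fact p))"
    by (simp add: algebra_simps)
  also have "\<dots> = fact (2 * Suc p)" unfolding Suc by (simp add: algebra_simps)
  finally show ?case .
qed (simp add: dfact_def)

text \<open>The integral of exp(-t^2/2) t^s over the positive half-line: the power of 1/2 rescales
  \<open>gauss_moment\<close> to the rate a = 1/2.\<close>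

definition half_gauss_moment :: "nat \<Rightarrow> complex" where
  "half_gauss_moment s = of_real (gauss_moment s * (1/2) powr (- (real s + 1) / real 2))"

text \<open>Even moments carry the factor sqrt(pi/2) and odd double factorials, which is the source
  of \<open>gam\<close>; the odd moments, with even double factorials, lead to
  \<open>rho\<close>.\<close>

lemma half_gauss_moment_even:
  "half_gauss_moment (2 * p) = of_real (sqrt (pi / 2)) * of_int (dfact (2 * int p - 1))"
proof -
  have "real_of_int (dfact (2 * int p - 1)) * (2 ^ p * fact p) = fact (2 * p)"
    using arg_cong[OF dfact_odd[of p], of real_of_int] by simp
  then have d: "real_of_int (dfact (2 * int p - 1)) = fact (2 * p) / (2 ^ p * fact p)"
    by (simp add: field_simps)
  have "- (real (2 * p) + 1) / real 2 = - (real p + 1/2)" by (simp add: field_simps)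
  then have "(1/2::real) powr (- (real (2 * p) + 1) / real 2) = (1/2) powr (- (real p + 1/2))" by (simp only:)
  also have "\<dots> = 2 powr (real p + 1/2)"
    by (simp only: powr_minus powr_divide) (simp add: powr_divide)
  also have "\<dots> = 2 ^ p * sqrt 2"
    by (simp add: powr_add powr_realpow powr_half_sqrt)
  finally have h: "(1/2::real) powr (- (real (2 * p) + 1) / real 2) = 2 ^ p * sqrt 2" .
  have "sqrt pi * sqrt 2 / 2 = sqrt (pi / 2)"
    by (simp add: real_sqrt_divide field_simps)
  moreover have "(2::real) ^ (2 * p) = 2 ^ p * 2 ^ p" by (simp add: power_add[symmetric] mult_2)
  ultimately have "gauss_moment (2 * p) * (1/2) powr (- (real (2 * p) + 1) / real 2) =
      sqrt (pi / 2) * real_of_int (dfact (2 * int p - 1))"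
    unfolding h d by (simp add: gauss_moment_def field_simps)
  then show ?thesis unfolding half_gauss_moment_def by simp
qed

lemma half_gauss_moment_odd: "half_gauss_moment (2 * p + 1) = of_int (dfact (2 * int p))"
proof -
  have "- (real (2 * p + 1) + 1) / real 2 = - real (Suc p)" by simp
  then have "(1/2::real) powr (- (real (2 * p + 1) + 1) / real 2) = (1/2) powr (- real (Suc p))" by (simp only:)
  also have "\<dots> = 2 ^ Suc p"
    by (subst powr_minus, subst powr_realpow) (auto simp: power_one_over)
  finally have "gauss_moment (2 * p + 1) * (1/2) powr (- (real (2 * p + 1) + 1) / real 2) = 2 ^ p * fact p"
    by (simp add: gauss_moment_def)
  then have "half_gauss_moment (2 * p + 1) = of_real (2 ^ p * fact p)"
    unfolding half_gauss_moment_def by simp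
  then show ?thesis by (simp add: dfact_even)
qed

lemma gauss_moment_real_scaled:
  fixes b :: real
  assumes "b > 0" "n > 0"
  shows "has_bochner_integral lborel (\<lambda>t. indicator {0..} t *\<^sub>R (exp (- (n * b * t ^ 2)) * t ^ s))
        (gauss_moment s * b powr (- (real s + 1) / real 2) * n powr (- (real s + 1) / real 2))"
  using gauss_moment_scaled[of "n * b" s] assms by (simp add: powr_mult mult_ac)

lemma gauss_moment_half_scaled:
  assumes "n > 0"
  shows "has_bochner_integral lborel
        (\<lambda>t. indicator {0..} t *\<^sub>R (exp (- (of_real n * (1/2) * of_real t ^ 2)) * of_real t ^ s))
        (half_gauss_moment s * of_real (n powr (- (real s + 1) / real 2)))"
proof -
  have "has_bochner_integral lborel (\<lambda>t. complex_of_real (indicator {0..} t *\<^sub>R (exp (- (n * (1/2) * t ^ 2)) * t ^ s)))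
        (of_real (gauss_moment s * (1/2) powr (- (real s + 1) / real 2) * n powr (- (real s + 1) / real 2)))"
    using assms by (intro has_bochner_integral_of_real gauss_moment_real_scaled) auto
  also have "(\<lambda>t. complex_of_real (indicator {0..} t *\<^sub>R (exp (- (n * (1/2) * t ^ 2)) * t ^ s))) =
     (\<lambda>t. indicator {0..} t *\<^sub>R (exp (- (of_real n * (1/2) * of_real t ^ 2)) * of_real t ^ s))"
    by (auto simp: fun_eq_iff exp_of_real[symmetric] split: split_indicator)
  finally show ?thesis by (simp add: half_gauss_moment_def)
qed

text \<open>At w = 1 the linear term cancels: t + log(1 - t) starts with -t^2/2, so p = 2 and a =
  1/2, and the expansion runs in powers of the square root of n.\<close>

lemma left_expansion_1:
  "(\<lambda>n. left_integral n 1 v - (\<Sum>q<Q. log_coeff 2 1 half_gauss_moment v q *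
            of_real (n powr (- (real q + 1) / real 2))))
         \<in> O[at_top](\<lambda>n. of_real (n powr (- (real Q + 1) / real 2)))"
  unfolding left_integral_def
proof (rule log_phase_expansion)
  show "Re (1/2) > 0" by simp
  show "left_phase 1 t = - ((1/2) * of_real t ^ 2) + Ln (1 - 1 * of_real t) +
      (\<Sum>i=1..2. (1 * of_real t) ^ i / of_nat i)" for t
    by (simp add: left_phase_def numeral_2_eq_2)
  show "\<exists>\<eta>>0. \<forall>t\<in>{0..<1}. t \<ge> d \<longrightarrow> Re (left_phase 1 t) \<le> -\<eta>" if d: "d > 0" for d
  proof (cases "d < 1")
    case True
    have neg: "ln (1 - d) + d < 0"
    proof -
      have "ln (1 - d) \<noteq> (1 - d) - 1" using ln_eq_minus_one[of "1 - d"] True d by auto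
      moreover have "ln (1 - d) \<le> (1 - d) - 1" using True by (intro ln_le_minus_one) simp
      ultimately show ?thesis by linarith
    qed
    show ?thesis
    proof (intro exI[of _ "- (ln (1 - d) + d)"] conjI ballI impI)
      fix t :: real assume "t \<in> {0..<1}" "t \<ge> d"
      then show "Re (left_phase 1 t) \<le> - (- (ln (1 - d) + d))"
        using ln_one_minus_plus_le[of d t] d by (simp add: left_phase_def Ln_one_minus_of_real)
    qed (use neg in simp)
  next
    case False
    \<comment> \<open>For d >= 1 no point of [0,1) lies beyond d, so any positive bound
      works.\<close>
    then show ?thesis by (intro exI[of _ 1]) auto
  qed
  show "set_integrable lborel {0..<1} (\<lambda>t. exp (of_real (norm v) * left_phase 1 t) * (1 - of_real t) powr v)"
    by (rule left_integrable) simp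
  show "\<exists>C. \<forall>n>0. has_bochner_integral lborel
        (\<lambda>t. indicator {0..} t *\<^sub>R (exp (- (n * b * t ^ 2)) * t ^ Q))
        (C * n powr (- (real Q + 1) / real 2))" if "b > 0" for b
    using gauss_moment_real_scaled[OF that] by blast
  show "has_bochner_integral lborel
        (\<lambda>t. indicator {0..} t *\<^sub>R (exp (- (of_real n * (1/2) * of_real t ^ 2)) * of_real t ^ s))
        (half_gauss_moment s * of_real (n powr (- (real s + 1) / real 2)))" if "n > 0" for n s
    using that by (rule gauss_moment_half_scaled)
qed auto

lemma right_expansion_1:
  "(\<lambda>n. right_integral n 1 v - (\<Sum>q<Q. log_coeff 2 (-1) half_gauss_moment v q *
            of_real (n powr (- (real q + 1) / real 2))))
         \<in> O[at_top](\<lambda>n. of_real (n powr (- (real Q + 1) / real 2)))"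
  unfolding right_integral_def
proof (rule log_phase_expansion)
  show "Re (1/2) > 0" by simp
  show "right_phase 1 t = - ((1/2) * of_real t ^ 2) + Ln (1 - (-1) * of_real t) +
      (\<Sum>i=1..2. ((-1) * of_real t) ^ i / of_nat i)" for t
    by (simp add: right_phase_def numeral_2_eq_2)
  show "(1 + of_real t / 1) powr v = (1 - (-1) * of_real t) powr v" for t by simp
  show "\<exists>\<eta>>0. \<forall>t\<in>{0..}. t \<ge> d \<longrightarrow> Re (right_phase 1 t) \<le> -\<eta>" if d: "d > 0" for d
    using that by (intro right_phase_away) auto
  show "set_integrable lborel {0..} (\<lambda>t. exp (of_real 1 * right_phase 1 t) * (1 + of_real t / 1) powr v)"
    by (rule right_integrable) auto
  show "\<exists>C. \<forall>n>0. has_bochner_integral lborel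
        (\<lambda>t. indicator {0..} t *\<^sub>R (exp (- (n * b * t ^ 2)) * t ^ Q))
        (C * n powr (- (real Q + 1) / real 2))" if "b > 0" for b
    using gauss_moment_real_scaled[OF that] by blast
  show "has_bochner_integral lborel
        (\<lambda>t. indicator {0..} t *\<^sub>R (exp (- (of_real n * (1/2) * of_real t ^ 2)) * of_real t ^ s))
        (half_gauss_moment s * of_real (n powr (- (real s + 1) / real 2)))" if "n > 0" for n s
    using that by (rule gauss_moment_half_scaled)
qed auto

text \<open>For p = 2 the factor \<sigma>^(p k) is 1, so the sign of \<sigma> enters only through
  (-\<sigma>)^q. This parity makes odd terms cancel and even terms double when the two sides are
  added.\<close>

lemma log_coeff_gauss_minus: "log_coeff 2 (-1) M v q = (-1) ^ q * log_coeff 2 1 M v q"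
  by (simp add: log_coeff_def power_mult flip: mult.assoc power_mult_distrib)

lemma log_coeff_gauss_even:
  "log_coeff 2 1 half_gauss_moment v (2 * r) = of_real (sqrt (pi / 2)) * gam r v"
proof -
  have "half_gauss_moment (2 * k + 2 * r) = of_real (sqrt (pi / 2)) * of_int (dfact (2 * int r + 2 * int k - 1))" for k
    using half_gauss_moment_even[of "k + r"] by (simp add: algebra_simps)
  then show ?thesis
    unfolding log_coeff_def gam_def deMoivre_seq3 sum_distrib_left atLeast0AtMost
    by (intro sum.cong refl) (simp add: field_simps)
qed

text \<open>The odd index makes the prefactor (-1)^(2r+1) = -1, which is the minus sign in
  \<open>rho\<close>.\<close>

lemma log_coeff_gauss_odd:
  "log_coeff 2 1 half_gauss_moment v (2 * r + 1) = rho r v - (if r = 0 then 1 else 0)"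
proof -
  have "half_gauss_moment (2 * k + (2 * r + 1)) = of_int (dfact (2 * int r + 2 * int k))" for k
    using half_gauss_moment_odd[of "k + r"] by (simp add: algebra_simps)
  moreover have "(- 1) ^ k / fact k = 1 / ((- 1) ^ k * fact k :: complex)" for k
    by (simp add: field_simps)
  ultimately have "(- 1) ^ k / fact k * 1 ^ (2 * k) * T * half_gauss_moment (2 * k + (2 * r + 1)) =
      of_int (dfact (2 * int r + 2 * int k)) / ((-1) ^ k * fact k) * T" for k T
    by simp
  moreover have "(- 1) ^ (2 * r + 1) = (- 1 :: complex)" by simp
  ultimately show ?thesis
    unfolding log_coeff_def rho_def deMoivre_seq3 atLeast0AtMost by simp
qed

lemma sum_lessThan_double: "(\<Sum>q<2 * R. f q) = (\<Sum>r<R. f (2 * r) + f (2 * r + 1))"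
  for f :: "nat \<Rightarrow> 'a :: comm_monoid_add"
  by (induction R) (simp_all add: add.assoc)

lemma powr_half_integers:
  fixes n :: real
  assumes "n > 0"
  shows "n * n powr (- (real (2 * r) + 1) / real 2) = sqrt n / n ^ r"
    and "n * n powr (- (real (2 * r + 1) + 1) / real 2) = 1 / n ^ r"
    and "n * n powr (- (real (2 * r) + 1) / real 2) = 1 / n powr (real r - 1/2)"
proof -
  have e: "1 + - (real (2 * r) + 1) / real 2 = 1/2 - real r"
          "1 + - (real (2 * r + 1) + 1) / real 2 = - real r"
    by (simp_all add: field_simps)
  have "n * n powr x = n powr (1 + x)" for x using assms by (simp add: powr_add)
  then have *: "n * n powr (- (real (2 * r) + 1) / real 2) = n powr (1/2 - real r)"
    "n * n powr (- (real (2 * r + 1) + 1) / real 2) = n powr (- real r)"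
    by (simp_all only: e)
  show "n * n powr (- (real (2 * r) + 1) / real 2) = sqrt n / n ^ r"
    unfolding * powr_diff using assms by (simp add: powr_half_sqrt powr_realpow)
  show "n * n powr (- (real (2 * r + 1) + 1) / real 2) = 1 / n ^ r"
    unfolding * powr_minus using assms by (simp add: powr_realpow inverse_eq_divide)
  show "n * n powr (- (real (2 * r) + 1) / real 2) = 1 / n powr (real r - 1/2)"
    unfolding * powr_minus_divide[symmetric] by simp
qed

text \<open>Cutting at 2R keeps R complete pairs of an even and an odd term. The first omitted index
  is even, so after multiplication by n the error is n^(1/2 - R).\<close>

lemma half_integer_expansion:
  fixes I :: "real \<Rightarrow> complex"
  assumes "(\<lambda>n. I n - (\<Sum>q<2 * R. c q * of_real (n powr (- (real q + 1) / real 2))))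
         \<in> O[at_top](\<lambda>n. of_real (n powr (- (real (2 * R) + 1) / real 2)))"
  shows "(\<lambda>n. of_real n * I n - (\<Sum>r<R. (c (2 * r) * of_real (sqrt n) + c (2 * r + 1)) / of_real n ^ r))
         \<in> O[at_top](\<lambda>n. of_real (1 / n powr (real R - 1/2)))"
proof -
  let ?E = "\<lambda>n. I n - (\<Sum>q<2 * R. c q * of_real (n powr (- (real q + 1) / real 2)))"
  have "(\<lambda>n. of_real n * ?E n) \<in> O[at_top](\<lambda>n. of_real (1 / n powr (real R - 1/2)))"
  proof (rule bigo_mult_of_real[OF _ assms])
    show "(\<lambda>n. of_real n) \<in> O[at_top](\<lambda>n. complex_of_real n)" by simp
    have "eventually (\<lambda>n::real. n * n powr (- (real (2 * R) + 1) / real 2) = 1 / n powr (real R - 1/2)) at_top"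
      using eventually_gt_at_top[of 0] by eventually_elim (rule powr_half_integers)
    then show "(\<lambda>n. n * n powr (- (real (2 * R) + 1) / real 2)) \<in> O[at_top](\<lambda>n. 1 / n powr (real R - 1/2))"
      by (rule landau_o.big.in_cong[THEN iffD2]) simp
  qed
  moreover have "eventually (\<lambda>n. of_real n * ?E n = of_real n * I n -
      (\<Sum>r<R. (c (2 * r) * of_real (sqrt n) + c (2 * r + 1)) / of_real n ^ r)) at_top"
    using eventually_gt_at_top[of 0]
  proof eventually_elim
    case (elim n)
    have pull: "of_real n * (a * of_real x + b * of_real y) = a * of_real (n * x) + b * of_real (n * y)"
      for a b :: complex and x y by (simp add: algebra_simps)
    have "of_real n * (\<Sum>q<2 * R. c q * of_real (n powr (- (real q + 1) / real 2))) =
       (\<Sum>r<R. (c (2 * r) * of_real (sqrt n) + c (2 * r + 1)) / of_real n ^ r)"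
      unfolding sum_lessThan_double sum_distrib_left pull powr_half_integers(1,2)[OF elim]
      by (simp add: add_divide_distrib)
    then show ?case by (simp add: right_diff_distrib)
  qed
  ultimately show ?thesis by (rule landau_o.big.in_cong[THEN iffD1, rotated])
qed

lemma sqrt_half_pi: "n \<ge> 0 \<Longrightarrow> sqrt (pi / 2) * sqrt n = sqrt (2 * pi * n) / 2"
proof -
  have "sqrt (2 * pi * n) = sqrt (2\<^sup>2 * ((pi / 2) * n))" by simp
  also have "\<dots> = 2 * sqrt ((pi / 2) * n)" by (simp only: real_sqrt_mult real_sqrt_abs abs_numeral)
  also have "sqrt ((pi / 2) * n) = sqrt (pi / 2) * sqrt n" by (rule real_sqrt_mult)
  finally show ?thesis by simp
qed

subsection \<open>Expansions of S\<close>

lemma S_fun_1_expansion: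
  assumes "R \<ge> 1"
  shows "(\<lambda>n::real. S_fun n 1 v -
        (\<Sum>r<R. (rho r v + gam r v / 2 * of_real (sqrt (2*pi*n))) / of_real n ^ r))
      \<in> O[at_top](\<lambda>n. of_real (1 / n powr (real R - 1/2)))"
proof -
  let ?c = "log_coeff 2 1 half_gauss_moment v"
  have "eventually (\<lambda>n. of_real n * left_integral n 1 v -
      (\<Sum>r<R. (?c (2 * r) * of_real (sqrt n) + ?c (2 * r + 1)) / of_real n ^ r) = S_fun n 1 v -
        (\<Sum>r<R. (rho r v + gam r v / 2 * of_real (sqrt (2*pi*n))) / of_real n ^ r)) at_top"
    using eventually_ge_at_top[of "max 1 (norm v)"]
  proof eventually_elim
    case (elim n)
    then have n: "n \<ge> norm v" "n \<ge> 0" by auto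
    have even: "?c (2 * r) * of_real (sqrt n) = gam r v / 2 * of_real (sqrt (2*pi*n))" for r
    proof -
      have "?c (2 * r) * of_real (sqrt n) = gam r v * of_real (sqrt (pi / 2) * sqrt n)"
        by (simp add: log_coeff_gauss_even)
      then show ?thesis unfolding sqrt_half_pi[OF n(2)] by simp
    qed
    have "(\<Sum>r<R. (?c (2 * r) * of_real (sqrt n) + ?c (2 * r + 1)) / of_real n ^ r) =
        (\<Sum>r<R. (rho r v + gam r v / 2 * of_real (sqrt (2*pi*n))) / of_real n ^ r - (if r = 0 then 1 else 0))"
      unfolding even log_coeff_gauss_odd
      by (intro sum.cong refl) (simp add: add_divide_distrib diff_divide_distrib)
    also have "\<dots> = (\<Sum>r<R. (rho r v + gam r v / 2 * of_real (sqrt (2*pi*n))) / of_real n ^ r) - 1"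
      unfolding sum_subtractf using assms by (simp add: sum.delta)
    finally show ?case using S_fun_eq_left_integral[OF n(1), of 1] by simp
  qed
  from landau_o.big.in_cong[OF this, THEN iffD1, OF half_integer_expansion[OF left_expansion_1]]
  show ?thesis .
qed

text \<open>Stirling's series: the odd terms of the two half-range expansions cancel.\<close>
lemma full_integral_expansion:
  "(\<lambda>n. of_real n * (left_integral n 1 v + right_integral n 1 v) -
        of_real (sqrt (2*pi*n)) * (\<Sum>r<R. gam r v / of_real n ^ r))
      \<in> O[at_top](\<lambda>n. of_real (1 / n powr (real R - 1/2)))"
proof -
  let ?c = "\<lambda>q. log_coeff 2 1 half_gauss_moment v q + log_coeff 2 (-1) half_gauss_moment v q"
  have "(\<lambda>n. (left_integral n 1 v + right_integral n 1 v) -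
      (\<Sum>q<2 * R. ?c q * of_real (n powr (- (real q + 1) / real 2))))
      \<in> O[at_top](\<lambda>n. of_real (n powr (- (real (2 * R) + 1) / real 2)))"
    using sum_in_bigo(1)[OF left_expansion_1[of v "2 * R"] right_expansion_1[of v "2 * R"]]
    by (simp add: sum.distrib ring_distribs algebra_simps)
  note half_integer_expansion[OF this]
  moreover have "eventually (\<lambda>n. of_real n * (left_integral n 1 v + right_integral n 1 v) -
      (\<Sum>r<R. (?c (2 * r) * of_real (sqrt n) + ?c (2 * r + 1)) / of_real n ^ r) =
      of_real n * (left_integral n 1 v + right_integral n 1 v) -
        of_real (sqrt (2*pi*n)) * (\<Sum>r<R. gam r v / of_real n ^ r)) at_top"
    using eventually_ge_at_top[of 0]
  proof eventually_elim
    case (elim n)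
    have "?c (2 * r + 1) = 0" for r
      by (simp add: log_coeff_gauss_minus)
    moreover have "?c (2 * r) * of_real (sqrt n) = of_real (sqrt (2*pi*n)) * gam r v" for r
    proof -
      have "?c (2 * r) * of_real (sqrt n) = 2 * gam r v * of_real (sqrt (pi / 2) * sqrt n)"
        by (simp add: log_coeff_gauss_minus log_coeff_gauss_even)
      then show ?thesis unfolding sqrt_half_pi[OF elim] by simp
    qed
    ultimately show ?case by (simp add: sum_distrib_left)
  qed
  ultimately show ?thesis by (rule landau_o.big.in_cong[THEN iffD1, rotated])
qed

text \<open>The prefactor exp(-n w) w^(n+v) is exp(-n) (w e^(1-w))^n w^v; dividing the contour
  identity by it isolates the left integral. The first summand always has the U-expansion, while the
  second is Stirling's series scaled by \<open>wpow\<close>.\<close>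

lemma S_fun_decomposition:
  assumes "Re w \<ge> 1" "n \<ge> 1" "n \<ge> norm v"
  shows "S_fun n w v = (1 + of_real n * (-1) * right_integral n w v) +
     of_real n * (left_integral n 1 v + right_integral n 1 v) / (wpow n w * w powr v)"
proof -
  define F where "F = left_integral n 1 v + right_integral n 1 v"
  have w0: "w \<noteq> 0" using assms by auto
  have e: "wpow n w * w powr v * exp (- of_real n) = exp (- of_real n * w) * w powr (of_real n + v)"
    using w0 by (simp add: wpow_def powr_def exp_add[symmetric] algebra_simps)
  have "exp (- of_real n) * (wpow n w * w powr v * (w * left_integral n w v + right_integral n w v)) =
      exp (- of_real n) * F"
    unfolding F_def left_right_integral_contour[OF assms, symmetric] e[symmetric] by (simp only: mult_ac)
  then have "wpow n w * w powr v * (w * left_integral n w v + right_integral n w v) = F" by simp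
  moreover have "wpow n w * w powr v \<noteq> 0" using w0 by (simp add: wpow_def powr_def)
  ultimately have "w * left_integral n w v = F / (wpow n w * w powr v) - right_integral n w v"
    by (simp add: field_simps)
  then have "S_fun n w v = 1 + of_real n * (F / (wpow n w * w powr v) - right_integral n w v)"
    by (simp add: S_fun_eq_left_integral[OF assms(3)] mult.assoc)
  then show ?thesis unfolding F_def by (simp add: algebra_simps)
qed

section \<open>Case distinction by the size of w exp(1 - w)\<close>

lemma norm_wpow: "w \<noteq> 0 \<Longrightarrow> norm (wpow n w) = exp (n * (ln (norm w) + 1 - Re w))"
  by (simp add: wpow_def algebra_simps)

lemma norm_mult_exp_eq: "w \<noteq> 0 \<Longrightarrow> norm (w * exp (1 - w)) = exp (ln (norm w) + 1 - Re w)"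
  by (simp add: norm_mult exp_add exp_diff norm_divide)

lemma left_U_expansion:
  assumes "Re w < 1" "R \<ge> 1"
  shows "(\<lambda>n. S_fun n w v - (\<Sum>r<R. U r w v / of_real n ^ r)) \<in> O[at_top](\<lambda>n. of_real (1 / n ^ R))"
proof -
  have "eventually (\<lambda>n. 1 + of_real n * w * left_integral n w v - (\<Sum>r<R. U r w v / of_real n ^ r) =
      S_fun n w v - (\<Sum>r<R. U r w v / of_real n ^ r)) at_top"
    using eventually_ge_at_top[of "norm v"] by eventually_elim (simp add: S_fun_eq_left_integral)
  from landau_o.big.in_cong[OF this, THEN iffD1, OF
      U_expansion[OF left_expansion[OF assms(1)] log_coeff_left_eq_U assms(2)]]
  show ?thesis .
qed

lemma right_U_expansion:
  assumes "Re w \<ge> 1" "w \<noteq> 1" "R \<ge> 1"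
  shows "(\<lambda>n. 1 + of_real n * (-1) * right_integral n w v - (\<Sum>r<R. U r w v / of_real n ^ r))
      \<in> O[at_top](\<lambda>n. of_real (1 / n ^ R))"
proof -
  have "w \<noteq> 0" using assms(1) by auto
  from U_expansion[OF right_expansion[OF assms(1,2)] log_coeff_right_eq_U[OF this] assms(3)]
  show ?thesis .
qed

lemma full_integral_bigo:
  "(\<lambda>n. of_real n * (left_integral n 1 v + right_integral n 1 v)) \<in> O[at_top](\<lambda>n. of_real (sqrt n))"
proof -
  have "(\<lambda>n. of_real n * (left_integral n 1 v + right_integral n 1 v)) \<in>
      O[at_top](\<lambda>n. of_real (1 / n powr (real 0 - 1/2)))"
    \<comment> \<open>With R = 0 the sum is empty and the error term is itself of order
      n^(1/2).\<close>
    using full_integral_expansion[of v 0] by simp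
  then show ?thesis by (rule bigo_of_real_trans) real_asymp
qed

text \<open>Here |w e^(1-w)| = e^L with L > 0, so the Stirling part of the decomposition decays
  exponentially and only the right integral contributes.\<close>

lemma regionX_expansion:
  assumes "w \<in> regionX" "Re w \<ge> 1" "R \<ge> 1"
  shows "(\<lambda>n. S_fun n w v - (\<Sum>r<R. U r w v / of_real n ^ r)) \<in> O[at_top](\<lambda>n. of_real (1 / n ^ R))"
proof -
  have w0: "w \<noteq> 0" using assms by auto
  have w1: "w \<noteq> 1" using assms by (auto simp: regionX_def)
  define L where "L = ln (norm w) + 1 - Re w"
  have nw: "norm (wpow n w) = exp (n * L)" for n
    by (simp add: norm_wpow[OF w0] L_def)
  have l: "L > 0"
    using assms(1) w0 by (simp add: regionX_def norm_mult_exp_eq L_def)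
  let ?F = "\<lambda>n. of_real n * (left_integral n 1 v + right_integral n 1 v)"
  have "(\<lambda>n. ?F n * (1 / (wpow n w * w powr v))) \<in> O[at_top](\<lambda>n. of_real (1 / n ^ R))"
  proof (rule bigo_mult_of_real[OF full_integral_bigo])
    show "(\<lambda>n. 1 / (wpow n w * w powr v)) \<in> O[at_top](\<lambda>n. of_real (exp (- (n * L))))"
      by (rule bigoI[where c = "1 / norm (w powr v)"])
        (simp add: norm_divide norm_mult nw exp_minus field_simps)
    show "(\<lambda>n. sqrt n * exp (- (n * L))) \<in> O[at_top](\<lambda>n. 1 / n ^ R)"
      using l by real_asymp
  qed
  from sum_in_bigo(1)[OF right_U_expansion[OF assms(2) w1 assms(3), of v] this]
  have "(\<lambda>n. 1 + of_real n * (-1) * right_integral n w v - (\<Sum>r<R. U r w v / of_real n ^ r) +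
      ?F n * (1 / (wpow n w * w powr v))) \<in> O[at_top](\<lambda>n. of_real (1 / n ^ R))" .
  moreover have "eventually (\<lambda>n. 1 + of_real n * (-1) * right_integral n w v - (\<Sum>r<R. U r w v / of_real n ^ r) +
      ?F n * (1 / (wpow n w * w powr v)) = S_fun n w v - (\<Sum>r<R. U r w v / of_real n ^ r)) at_top"
    using eventually_ge_at_top[of "max 1 (norm v)"]
    by eventually_elim (simp add: S_fun_decomposition[OF assms(2)])
  ultimately show ?thesis by (rule landau_o.big.in_cong[THEN iffD1, rotated])
qed

text \<open>With |w e^(1-w)| = 1 neither part of the decomposition dominates exponentially. The
  error n^(-R) of the U-part is absorbed by the error n^(1/2 - R) of the Stirling part.\<close>

lemma regionT_expansion:
  assumes "w \<in> regionT" "R \<ge> 1"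
  shows "(\<lambda>n::real. S_fun n w v -
        (\<Sum>r<R. (U r w v + gam r v * exp (\<i> * of_real (n * phi w)) / w powr v
                     * of_real (sqrt (2*pi*n))) / of_real n ^ r))
      \<in> O[at_top](\<lambda>n. of_real (1 / n powr (real R - 1/2)))"
proof -
  have w: "Re w \<ge> 1" "w \<noteq> 1" "w \<noteq> 0" using assms by (auto simp: regionT_def)
  have l: "ln (norm w) + 1 - Re w = 0"
    using assms(1) w by (simp add: regionT_def norm_mult_exp_eq)
  have wp: "1 / wpow n w = exp (\<i> * of_real (n * phi w))" for n
  proof -
    \<comment> \<open>The real part is zero by the modulus condition, and the imaginary part is Arg
      w - Im w.\<close>
    have "Ln w + (1 - w) = - (\<i> * of_real (phi w))"
      using l w by (simp add: complex_eq_iff phi_def Arg_eq_Im_Ln)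
    then have "of_real n * Ln w + of_real n * (1 - w) = - (\<i> * of_real (n * phi w))"
      by (simp flip: distrib_left)
    then show ?thesis by (simp add: wpow_def exp_minus inverse_eq_divide)
  qed
  let ?F = "\<lambda>n. of_real n * (left_integral n 1 v + right_integral n 1 v)"
  let ?G = "\<lambda>n. of_real (sqrt (2*pi*n)) * (\<Sum>r<R. gam r v / of_real n ^ r)"
  have "(\<lambda>n. (?F n - ?G n) * (exp (\<i> * of_real (n * phi w)) / w powr v)) \<in>
      O[at_top](\<lambda>n. of_real (1 / n powr (real R - 1/2)))"
  proof (rule bigo_mult_of_real[OF full_integral_expansion])
    show "(\<lambda>n. exp (\<i> * of_real (n * phi w)) / w powr v) \<in> O[at_top](\<lambda>n. of_real 1)"
      by (rule bigoI[where c = "1 / norm (w powr v)"]) (simp add: norm_divide)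
  qed simp
  moreover have "(\<lambda>n. 1 + of_real n * (-1) * right_integral n w v - (\<Sum>r<R. U r w v / of_real n ^ r))
      \<in> O[at_top](\<lambda>n. of_real (1 / n powr (real R - 1/2)))"
    using right_U_expansion[OF w(1,2) assms(2)] by (rule bigo_of_real_trans) real_asymp
  ultimately have "(\<lambda>n. (?F n - ?G n) * (exp (\<i> * of_real (n * phi w)) / w powr v) +
      (1 + of_real n * (-1) * right_integral n w v - (\<Sum>r<R. U r w v / of_real n ^ r)))
      \<in> O[at_top](\<lambda>n. of_real (1 / n powr (real R - 1/2)))"
    by (rule sum_in_bigo)
  moreover have "eventually (\<lambda>n. (?F n - ?G n) * (exp (\<i> * of_real (n * phi w)) / w powr v) +
      (1 + of_real n * (-1) * right_integral n w v - (\<Sum>r<R. U r w v / of_real n ^ r)) =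
      S_fun n w v - (\<Sum>r<R. (U r w v + gam r v * exp (\<i> * of_real (n * phi w)) / w powr v
                     * of_real (sqrt (2*pi*n))) / of_real n ^ r)) at_top"
    using eventually_ge_at_top[of "max 1 (norm v)"]
  proof eventually_elim
    case (elim n)
    define X where "X = exp (\<i> * of_real (n * phi w)) / w powr v"
    have "?F n / (wpow n w * w powr v) = ?F n * X"
      unfolding X_def wp[symmetric] by simp
    then have "S_fun n w v = (1 + of_real n * (-1) * right_integral n w v) + ?F n * X"
      using S_fun_decomposition[OF w(1), of n v] elim by simp
    moreover have "(\<Sum>r<R. (U r w v + gam r v * exp (\<i> * of_real (n * phi w)) / w powr v
                     * of_real (sqrt (2*pi*n))) / of_real n ^ r) =
        (\<Sum>r<R. U r w v / of_real n ^ r) + ?G n * X"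
      unfolding sum_distrib_left sum_distrib_right sum.distrib[symmetric] X_def
      by (intro sum.cong refl) (simp add: add_divide_distrib mult_ac)
    ultimately show ?case unfolding X_def[symmetric] by (simp add: algebra_simps)
  qed
  ultimately show ?thesis by (rule landau_o.big.in_cong[THEN iffD1, rotated])
qed

text \<open>Now L < 0, so dividing by \<open>wpow\<close> makes the Stirling part exponentially
  large. Relative to it the bounded U-part is smaller than every power of n.\<close>

lemma regionZ_expansion:
  assumes "w \<in> regionZ" "R \<ge> 1"
  shows "\<exists>E. (E :: real \<Rightarrow> complex) \<in> O[at_top](\<lambda>n. of_real (1 / n ^ R)) \<and>
        (\<forall>\<^sub>F n in at_top. S_fun n w v =
           of_real (sqrt (2*pi*n)) / (wpow n w * w powr v) * ((\<Sum>r<R. gam r v / of_real n ^ r) + E n))"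
proof -
  have w: "Re w \<ge> 1" "w \<noteq> 1" "w \<noteq> 0" using assms by (auto simp: regionZ_def)
  define L where "L = ln (norm w) + 1 - Re w"
  have l: "L < 0"
    using assms(1) w by (simp add: regionZ_def norm_mult_exp_eq L_def)
  let ?F = "\<lambda>n. of_real n * (left_integral n 1 v + right_integral n 1 v)"
  let ?G = "\<lambda>n. of_real (sqrt (2*pi*n)) * (\<Sum>r<R. gam r v / of_real n ^ r)"
  let ?W = "\<lambda>n. wpow n w * w powr v"
  let ?A = "\<lambda>n. 1 + of_real n * (-1) * right_integral n w v"
  \<comment> \<open>Obtained by solving the claimed identity for the error: the Stirling remainder
    divided by sqrt(2 pi n), plus the U-part rescaled by the reciprocal of the prefactor.\<close>
  define E where "E n = (?F n - ?G n) * (1 / of_real (sqrt (2*pi*n))) + ?A n * (?W n / of_real (sqrt (2*pi*n)))" for n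
  have "(\<lambda>n. (?F n - ?G n) * (1 / of_real (sqrt (2*pi*n)))) \<in> O[at_top](\<lambda>n. of_real (1 / n ^ R))"
  proof (rule bigo_mult_of_real[OF full_integral_expansion])
    show "(\<lambda>n. 1 / of_real (sqrt (2*pi*n))) \<in> O[at_top](\<lambda>n. complex_of_real (1 / sqrt (2*pi*n)))" by simp
    show "(\<lambda>n. 1 / n powr (real R - 1/2) * (1 / sqrt (2*pi*n))) \<in> O[at_top](\<lambda>n. 1 / n ^ R)" by real_asymp
  qed
  moreover have "(\<lambda>n. ?A n * (?W n / of_real (sqrt (2*pi*n)))) \<in> O[at_top](\<lambda>n. of_real (1 / n ^ R))"
  proof (rule bigo_mult_of_real)
    \<comment> \<open>The one-term expansion already shows that \<open>?A\<close> is bounded;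
      \<open>wpow\<close> supplies the exponential decay.\<close>
    have "(\<lambda>n. ?A n - (\<Sum>r<1. U r w v / of_real n ^ r)) \<in> O[at_top](\<lambda>n. of_real 1)"
      using right_U_expansion[OF w(1,2) order.refl] by (rule bigo_of_real_trans) real_asymp
    moreover have "(\<lambda>n::real. \<Sum>r<1. U r w v / of_real n ^ r) \<in> O[at_top](\<lambda>n. of_real 1)" by simp
    ultimately have "(\<lambda>n. (?A n - (\<Sum>r<1. U r w v / of_real n ^ r)) + (\<Sum>r<1. U r w v / of_real n ^ r)) \<in> O[at_top](\<lambda>n. of_real 1)"
      by (rule sum_in_bigo)
    then show "?A \<in> O[at_top](\<lambda>n. of_real 1)" by simp
    show "(\<lambda>n. ?W n / of_real (sqrt (2*pi*n))) \<in> O[at_top](\<lambda>n. of_real (exp (n * L) / sqrt (2*pi*n)))"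
      by (rule bigoI[where c = "norm (w powr v)"])
        (use w in \<open>simp add: norm_divide norm_mult norm_wpow L_def mult_ac\<close>)
    show "(\<lambda>n. 1 * (exp (n * L) / sqrt (2*pi*n))) \<in> O[at_top](\<lambda>n. 1 / n ^ R)"
      using l by real_asymp
  qed
  ultimately have "E \<in> O[at_top](\<lambda>n. of_real (1 / n ^ R))"
    unfolding E_def by (rule sum_in_bigo)
  moreover have "\<forall>\<^sub>F n in at_top. S_fun n w v =
           of_real (sqrt (2*pi*n)) / ?W n * ((\<Sum>r<R. gam r v / of_real n ^ r) + E n)"
    using eventually_ge_at_top[of "max 1 (norm v)"]
  proof eventually_elim
    case (elim n)
    define s where "s = complex_of_real (sqrt (2*pi*n))"
    define G where "G = (\<Sum>r<R. gam r v / of_real n ^ r)"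
    have s: "s \<noteq> 0" using elim by (simp add: s_def)
    have W: "?W n \<noteq> 0" using w by (simp add: wpow_def powr_def)
    have "s / ?W n * (G + ((?F n - s * G) * (1 / s) + ?A n * (?W n / s))) = ?A n + ?F n / ?W n"
      using s W by (simp add: field_simps)
    then show ?case
      using S_fun_decomposition[OF w(1), of n v] elim by (simp add: E_def s_def G_def)
  qed
  ultimately show ?thesis by blast
qed

theorem theorem5p3:
  fixes w v :: complex and R :: nat
  assumes "R \<ge> 1"
  shows
   "((\<lambda>n::real. S_fun n 1 v -
        (\<Sum>r<R. (rho r v + gam r v / 2 * of_real (sqrt (2*pi*n))) / of_real n ^ r))
      \<in> O[at_top](\<lambda>n. of_real (1 / n powr (real R - 1/2)))) \<and>
   (w \<in> regionX \<union> regionY \<union> regionS \<longrightarrow>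
      (\<lambda>n::real. S_fun n w v - (\<Sum>r<R. U r w v / of_real n ^ r))
      \<in> O[at_top](\<lambda>n. of_real (1 / n ^ R))) \<and>
   (w \<in> regionT \<longrightarrow>
      (\<lambda>n::real. S_fun n w v -
        (\<Sum>r<R. (U r w v + gam r v * exp (\<i> * of_real (n * phi w)) / w powr v
                     * of_real (sqrt (2*pi*n))) / of_real n ^ r))
      \<in> O[at_top](\<lambda>n. of_real (1 / n powr (real R - 1/2)))) \<and>
   (w \<in> regionZ \<longrightarrow>
      (\<exists>E. (E :: real \<Rightarrow> complex) \<in> O[at_top](\<lambda>n. of_real (1 / n ^ R)) \<and>
        (\<forall>\<^sub>F n in at_top. S_fun n w v =
           of_real (sqrt (2*pi*n)) / (wpow n w * w powr v) * ((\<Sum>r<R. gam r v / of_real n ^ r) + E n))))"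
proof (intro conjI impI)
  assume "w \<in> regionX \<union> regionY \<union> regionS"
  \<comment> \<open>The regions Y and S lie in Re w < 1 by definition. Region X meets both
    half-planes: its part with Re w < 1 is handled by the left integral alone, the rest by the
    decomposition.\<close>
  then consider "Re w < 1" | "w \<in> regionX" "Re w \<ge> 1"
    by (auto simp: regionY_def regionS_def not_less[symmetric])
  then show "(\<lambda>n::real. S_fun n w v - (\<Sum>r<R. U r w v / of_real n ^ r)) \<in> O[at_top](\<lambda>n. of_real (1 / n ^ R))"
    by cases (simp_all only: left_U_expansion regionX_expansion assms)
qed (use assms in \<open>simp_all only: S_fun_1_expansion regionT_expansion regionZ_expansion\<close>)

end
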